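(* Let $\mathcal{A}\in\mathbb{R}^{n_1\times n_2\times n_3}$ and let $k_1,k_2,k_3$ be integers such that $1\le k_\mu\le n_\mu$ and $\operatorname{rank}(A^{(\mu)})\ge k_\mu$ for $\mu=1,2,3$. For $\mu=1,2,3$ let $B_\mu = A^{(\mu)}(:,S_\mu)\in\mathbb{R}^{n_\mu\times k_\mu}$, where $S_\mu$ is the tuple of $k_\mu$ column indices returned by the column subset selection algorithm (defined in the context) applied to the $\mu$-mode matricization $A^{(\mu)}$ and $k_\mu$, and let $\mathcal{C}=B_1^{+}\times_1 B_2^{+}\times_2 B_3^{+}\times_3\mathcal{A}\in\mathbb{R}^{k_1\times k_2\times k_3}$. Then $$\| \mathcal{A} - B_1\times_1 B_2\times_2 B_3\times_3\mathcal{C}\|_F \le \sqrt{k_1+k_2+k_3+3}\;\|\mathcal{A}-\mathcal{A}_{\mathrm{best}}\|_F,$$ where $\mathcal{A}_{\mathrm{best}}$ is a best approximation of $\mathcal{A}$ in the Frobenius norm among tensors of multilinear rank at most $(k_1,k_2,k_3)$.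
   Context: Tensor notation: the $\mu$-mode fibers of $\mathcal{A}$ are the vectors obtained by fixing all indices but the $\mu$th one. The $\mu$-mode matricization $A^{(\mu)}\in\mathbb{R}^{n_\mu\times (n_1n_2n_3)/n_\mu}$ is the matrix whose columns are all $\mu$-mode fibers of $\mathcal{A}$ (in a fixed order). For $B\in\mathbb{R}^{m\times n_\mu}$, the $\mu$-mode product $B\times_\mu\mathcal{A}$ is the tensor whose $\mu$-mode matricization is $B\cdot A^{(\mu)}$; an expression $B_1\times_1 B_2\times_2 B_3\times_3\mathcal{C}$ means $B_1\times_1(B_2\times_2(B_3\times_3\mathcal{C}))$. The Frobenius norm is $\|\mathcal{A}\|_F^2=\sum_{i_1,i_2,i_3}\mathcal{A}(i_1,i_2,i_3)^2$. The multilinear rank of $\mathcal{A}$ is the tuple $(\operatorname{rank}A^{(1)},\operatorname{rank}A^{(2)},\operatorname{rank}A^{(3)})$, and "at most" is meant entrywise. $(\cdot)^+$ is the Moore–Penrose inverse, and $M(:,S)$ is the submatrix of $M$ formed by the columns with indices in the tuple $S$. For a $p\times q$ real matrix $B$, the coefficients $c_j(BB^T)$, $0\le j\le p$, are defined by $$\det(BB^T-\lambda\,\mathrm{Id}) = (-\lambda)^p + c_{p-1}(-\lambda)^{p-1}+\dots+c_1(-\lambda)+c_0,$$ with $c_p=1$ (so $c_j(BB^T)$ is the elementary symmetric polynomial of degree $p-j$ in the eigenvalues of $BB^T$). Column subset selection algorithm (in exact arithmetic): Input a $p\times q$ real matrix $M$ and an integer $k$ with $1\le k\le \operatorname{rank}(M)$.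 Set $S=()$ (empty tuple) and $B=M$. For $t=1,\dots,k$: (1) for each $i\in\{1,\dots,q\}$ such that the $i$th column $b_i$ of $B$ is nonzero, let $B_i=\left(\mathrm{Id}-\frac{b_ib_i^T}{\|b_i\|_2^2}\right)B$ and compute the ratio $$\frac{c_{p-k+t-1}(B_iB_i^T)}{c_{p-k+t}(B_iB_i^T)};$$ (2) let $i_t$ be an index $i$ minimizing this ratio (any minimizer) and append $i_t$ to $S$; (3) set $B = M-M(:,S)M(:,S)^+M$. Return $S=(i_1,\dots,i_k)$. *)

theory Defs
  imports Complex_Main "Jordan_Normal_Form.DL_Rank" "Jordan_Normal_Form.Char_Poly"
begin

section \<open>Real tensors of order three\<close>

text \<open>As for matrices in \<^theory>\<open>Jordan_Normal_Form.Matrix\<close>, the size is part of the value and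
  indices start at 0. Entries outside the index range are 0, so that equality is extensional.\<close>

typedef tensor3 =
  "{(n1, n2, n3, f) :: nat \<times> nat \<times> nat \<times> (nat \<Rightarrow> nat \<Rightarrow> nat \<Rightarrow> real) | n1 n2 n3 f.
      \<forall>i1 i2 i3. \<not> (i1 < n1 \<and> i2 < n2 \<and> i3 < n3) \<longrightarrow> f i1 i2 i3 = 0}"
  by (rule exI[of _ "(0, 0, 0, \<lambda>_ _ _. 0)"]) simp

setup_lifting type_definition_tensor3

lift_definition tensor :: "nat \<times> nat \<times> nat \<Rightarrow> (nat \<Rightarrow> nat \<Rightarrow> nat \<Rightarrow> real) \<Rightarrow> tensor3"
  is "\<lambda>(n1, n2, n3) f.
        (n1, n2, n3, \<lambda>i1 i2 i3. if i1 < n1 \<and> i2 < n2 \<and> i3 < n3 then f i1 i2 i3 else 0)"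
  by auto

lift_definition dims :: "tensor3 \<Rightarrow> nat \<times> nat \<times> nat"
  is "\<lambda>(n1, n2, n3, f). (n1, n2, n3)" .

lift_definition entry :: "tensor3 \<Rightarrow> nat \<Rightarrow> nat \<Rightarrow> nat \<Rightarrow> real"
  is "\<lambda>(n1, n2, n3, f). f" .

lemma dims_tensor [simp]: "dims (tensor d f) = d"
  by transfer auto

lemma entry_tensor [simp]:
  "entry (tensor (n1, n2, n3) f) i1 i2 i3
     = (if i1 < n1 \<and> i2 < n2 \<and> i3 < n3 then f i1 i2 i3 else 0)"
  by transfer auto

lemma tensor3_eqI:
  assumes "dims A = (n1, n2, n3)" "dims B = (n1, n2, n3)"
    and "\<And>i1 i2 i3. i1 < n1 \<Longrightarrow> i2 < n2 \<Longrightarrow> i3 < n3 \<Longrightarrow> entry A i1 i2 i3 = entry B i1 i2 i3"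
  shows "A = B"
  using assms
proof (transfer, goal_cases)
  case (1 A n1 n2 n3 B)
  then obtain f g where fg: "A = (n1, n2, n3, f)" "B = (n1, n2, n3, g)"
    by (cases A; cases B) auto
  have "f i1 i2 i3 = g i1 i2 i3" for i1 i2 i3
  proof (cases "i1 < n1 \<and> i2 < n2 \<and> i3 < n3")
    case True
    with 1(5) show ?thesis by (simp add: fg)
  next
    case False
    with 1 show ?thesis by (simp add: fg)
  qed
  then show ?case by (simp add: fg fun_eq_iff)
qed

instantiation tensor3 :: minus
begin

definition minus_tensor3 :: "tensor3 \<Rightarrow> tensor3 \<Rightarrow> tensor3" where
  "A - B = tensor (dims A) (\<lambda>i1 i2 i3. entry A i1 i2 i3 - entry B i1 i2 i3)"

instance ..

end

definition frob_norm :: "tensor3 \<Rightarrow> real" where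
  "frob_norm A = (case dims A of (n1, n2, n3) \<Rightarrow>
     sqrt (\<Sum>i1<n1. \<Sum>i2<n2. \<Sum>i3<n3. (entry A i1 i2 i3)\<^sup>2))"

datatype mode = Mode1 | Mode2 | Mode3

text \<open>The columns of a matricization are ordered so that, of the two remaining indices, the one
  with the smaller mode varies fastest.\<close>

fun matricize :: "mode \<Rightarrow> tensor3 \<Rightarrow> real mat" where
  "matricize Mode1 A = (case dims A of (n1, n2, n3) \<Rightarrow>
     mat n1 (n2 * n3) (\<lambda>(i, j). entry A i (j mod n2) (j div n2)))"
| "matricize Mode2 A = (case dims A of (n1, n2, n3) \<Rightarrow>
     mat n2 (n1 * n3) (\<lambda>(i, j). entry A (j mod n1) i (j div n1)))"
| "matricize Mode3 A = (case dims A of (n1, n2, n3) \<Rightarrow>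
     mat n3 (n1 * n2) (\<lambda>(i, j). entry A (j mod n1) (j div n1) i))"

fun tensorize :: "mode \<Rightarrow> nat \<times> nat \<times> nat \<Rightarrow> real mat \<Rightarrow> tensor3" where
  "tensorize Mode1 (n1, n2, n3) M = tensor (n1, n2, n3) (\<lambda>i1 i2 i3. M $$ (i1, i2 + n2 * i3))"
| "tensorize Mode2 (n1, n2, n3) M = tensor (n1, n2, n3) (\<lambda>i1 i2 i3. M $$ (i2, i1 + n1 * i3))"
| "tensorize Mode3 (n1, n2, n3) M = tensor (n1, n2, n3) (\<lambda>i1 i2 i3. M $$ (i3, i1 + n1 * i2))"

fun upd_dims :: "mode \<Rightarrow> nat \<Rightarrow> nat \<times> nat \<times> nat \<Rightarrow> nat \<times> nat \<times> nat" where
  "upd_dims Mode1 m (n1, n2, n3) = (m, n2, n3)"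
| "upd_dims Mode2 m (n1, n2, n3) = (n1, m, n3)"
| "upd_dims Mode3 m (n1, n2, n3) = (n1, n2, m)"

definition mode_prod :: "mode \<Rightarrow> real mat \<Rightarrow> tensor3 \<Rightarrow> tensor3" where
  "mode_prod \<mu> B A = tensorize \<mu> (upd_dims \<mu> (dim_row B) (dims A)) (B * matricize \<mu> A)"

lemma index_pair_less:
  assumes "(a :: nat) < m" "b < n"
  shows "a + m * b < m * n"
proof -
  have "a + m * b < m * Suc b" using assms by simp
  also have "\<dots> \<le> m * n" using assms by (intro mult_le_mono2) simp
  finally show ?thesis .
qed

lemma dims_tensorize [simp]: "dims (tensorize \<mu> d M) = d"
  by (cases d; cases \<mu>) simp_all

lemma dims_mode_prod: "dims (mode_prod \<mu> B A) = upd_dims \<mu> (dim_row B) (dims A)"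
  by (simp add: mode_prod_def)

lemma tensorize_matricize: "tensorize \<mu> (dims A) (matricize \<mu> A) = A"
proof -
  obtain n1 n2 n3 where d: "dims A = (n1, n2, n3)" by (cases "dims A")
  show ?thesis
    by (rule tensor3_eqI[OF _ d]; cases \<mu>; simp add: d index_pair_less)
qed

lemma matricize_inject:
  "dims A = dims B \<Longrightarrow> matricize \<mu> A = matricize \<mu> B \<Longrightarrow> A = B"
  by (metis tensorize_matricize)

lemma matricize_tensorize:
  "M \<in> carrier_mat n1 (n2 * n3) \<Longrightarrow> matricize Mode1 (tensorize Mode1 (n1, n2, n3) M) = M"
  "M \<in> carrier_mat n2 (n1 * n3) \<Longrightarrow> matricize Mode2 (tensorize Mode2 (n1, n2, n3) M) = M"
  "M \<in> carrier_mat n3 (n1 * n2) \<Longrightarrow> matricize Mode3 (tensorize Mode3 (n1, n2, n3) M) = M"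
proof -
  have *: "j div m < n" "j mod m < m" if "j < m * n" for j m n :: nat
  proof -
    from that show "j div m < n" by (simp add: less_mult_imp_div_less mult.commute)
    from that have "0 < m" by (cases m) auto
    then show "j mod m < m" by simp
  qed
  show "M \<in> carrier_mat n1 (n2 * n3) \<Longrightarrow> matricize Mode1 (tensorize Mode1 (n1, n2, n3) M) = M"
    "M \<in> carrier_mat n2 (n1 * n3) \<Longrightarrow> matricize Mode2 (tensorize Mode2 (n1, n2, n3) M) = M"
    "M \<in> carrier_mat n3 (n1 * n2) \<Longrightarrow> matricize Mode3 (tensorize Mode3 (n1, n2, n3) M) = M"
    by (rule eq_matI; simp add: *)+
qed

lemma matricize_mode_prod: "matricize \<mu> (mode_prod \<mu> B A) = B * matricize \<mu> A"
proof -
  obtain n1 n2 n3 where d: "dims A = (n1, n2, n3)" by (cases "dims A")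
  have c: "B * matricize Mode1 A \<in> carrier_mat (dim_row B) (n2 * n3)"
    "B * matricize Mode2 A \<in> carrier_mat (dim_row B) (n1 * n3)"
    "B * matricize Mode3 A \<in> carrier_mat (dim_row B) (n1 * n2)"
    by (auto intro!: carrier_matI simp: d)
  show ?thesis
    by (cases \<mu>) (use matricize_tensorize(1)[OF c(1)] matricize_tensorize(2)[OF c(2)]
      matricize_tensorize(3)[OF c(3)] in \<open>simp_all only: mode_prod_def d upd_dims.simps\<close>)
qed

definition mlrank_le :: "tensor3 \<Rightarrow> nat \<Rightarrow> nat \<Rightarrow> nat \<Rightarrow> bool" where
  "mlrank_le A k1 k2 k3 \<longleftrightarrow>
     (case dims A of (n1, n2, n3) \<Rightarrow>
        vec_space.rank n1 (matricize Mode1 A) \<le> k1 \<and>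
        vec_space.rank n2 (matricize Mode2 A) \<le> k2 \<and>
        vec_space.rank n3 (matricize Mode3 A) \<le> k3)"

definition best_mlrank_approx :: "tensor3 \<Rightarrow> nat \<Rightarrow> nat \<Rightarrow> nat \<Rightarrow> tensor3 \<Rightarrow> bool" where
  "best_mlrank_approx A k1 k2 k3 X \<longleftrightarrow>
     is_arg_min (\<lambda>Y. frob_norm (A - Y)) (\<lambda>Y. dims Y = dims A \<and> mlrank_le Y k1 k2 k3) X"

section \<open>Moore--Penrose inverse and column submatrices\<close>

definition is_pinv :: "real mat \<Rightarrow> real mat \<Rightarrow> bool" where
  "is_pinv M X \<longleftrightarrow>
     X \<in> carrier_mat (dim_col M) (dim_row M) \<and>
     M * X * M = M \<and> X * M * X = X \<and>
     transpose_mat (M * X) = M * X \<and> transpose_mat (X * M) = X * M"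

lemma is_pinv_unique:
  assumes "is_pinv M X" "is_pinv M Y"
  shows "X = Y"
proof -
  obtain m n where M: "M \<in> carrier_mat m n" by blast
  have X: "X \<in> carrier_mat n m" and Y: "Y \<in> carrier_mat n m"
    using assms M by (auto simp: is_pinv_def)
  note c = M X Y
  have x: "M * X * M = M" "X * M * X = X" "transpose_mat (M * X) = M * X"
      "transpose_mat (X * M) = X * M"
    and y: "M * Y * M = M" "Y * M * Y = Y" "transpose_mat (M * Y) = M * Y"
      "transpose_mat (Y * M) = Y * M"
    using assms by (auto simp: is_pinv_def)
  have MX: "M * X \<in> carrier_mat m m" and MY: "M * Y \<in> carrier_mat m m"
    and XM: "X * M \<in> carrier_mat n n" and YM: "Y * M \<in> carrier_mat n n"
    using c by auto
  have "M * X = (M * Y) * (M * X)"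
    using y(1) assoc_mult_mat[OF MY M X] by simp
  also have "\<dots> = transpose_mat ((M * X) * (M * Y))"
    using transpose_mult[OF MX MY] x(3) y(3) by simp
  also have "(M * X) * (M * Y) = M * Y"
    using x(1) assoc_mult_mat[OF MX M Y] by simp
  finally have 1: "M * X = M * Y" using y(3) by simp
  have "X * M = (X * M) * (Y * M)"
    using y(1) assoc_mult_mat[OF X M YM] assoc_mult_mat[OF M Y M] by simp
  also have "\<dots> = transpose_mat ((Y * M) * (X * M))"
    using transpose_mult[OF YM XM] x(4) y(4) by simp
  also have "(Y * M) * (X * M) = Y * M"
    using x(1) assoc_mult_mat[OF Y M XM] assoc_mult_mat[OF M X M] by simp
  finally have 2: "X * M = Y * M" using y(4) by simp
  have "X = Y * M * X" using x(2) 2 by simp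
  also have "\<dots> = Y * (M * Y)" using assoc_mult_mat[OF Y M X] 1 by simp
  also have "\<dots> = Y" using assoc_mult_mat[OF Y M Y] y(2) by simp
  finally show ?thesis .
qed

definition pinv :: "real mat \<Rightarrow> real mat" where
  "pinv M = (THE X. is_pinv M X)"

definition cols_sub :: "real mat \<Rightarrow> nat list \<Rightarrow> real mat" where
  "cols_sub M S = mat_of_cols (dim_row M) (map (col M) S)"

section \<open>Column subset selection\<close>

text \<open>\<open>det_coeff N j\<close> is the coefficient of \<open>(- \<lambda>) ^ j\<close> in \<open>det (N - \<lambda> Id)\<close>.\<close>

definition det_coeff :: "real mat \<Rightarrow> nat \<Rightarrow> real" where
  "det_coeff N j =
     (- 1) ^ j * coeff (det (map_mat (\<lambda>a. [:a:]) N - [:0, 1:] \<cdot>\<^sub>m 1\<^sub>m (dim_row N))) j"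

lemma det_minus_scalar_eq_det_coeff:
  assumes N: "N \<in> carrier_mat p p"
  shows "det (N - x \<cdot>\<^sub>m 1\<^sub>m p) = (\<Sum>j\<le>p. det_coeff N j * (- x) ^ j)"
    and "det_coeff N p = 1"
proof -
  define P where "P = map_mat (\<lambda>a. [:a:]) N - [:0, 1:] \<cdot>\<^sub>m 1\<^sub>m p"
  have dc: "det_coeff N j = (- 1) ^ j * coeff (det P) j" for j
    using N by (simp add: det_coeff_def P_def)
  have "P = (- 1) \<cdot>\<^sub>m char_poly_matrix N"
    using N unfolding P_def by (intro eq_matI) (auto simp: char_poly_matrix_def)
  then have "det P = (- 1) ^ p * char_poly N"
    using char_poly_matrix_closed[OF N] by (simp add: char_poly_def)
  also have "(- 1 :: real poly) ^ p = [:(- 1) ^ p:]"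
    by (induction p) (simp_all add: one_pCons)
  finally have P: "det P = smult ((- 1) ^ p) (char_poly N)"
    by simp
  have deg: "degree (det P) = p" and lc: "coeff (det P) p = (- 1) ^ p"
    using degree_monic_char_poly[OF N] by (simp_all add: P)
  show "det_coeff N p = 1"
    unfolding dc lc by (rule minus_one_mult_self)
  have "det (N - x \<cdot>\<^sub>m 1\<^sub>m p) = poly (det P) x"
    using N unfolding P_def by (intro poly_det_cong[symmetric, of _ p]) auto
  also have "\<dots> = (\<Sum>j\<le>p. coeff (det P) j * x ^ j)"
    by (simp add: poly_altdef deg)
  also have "\<dots> = (\<Sum>j\<le>p. det_coeff N j * (- x) ^ j)"
  proof (rule sum.cong)
    fix j
    have "det_coeff N j * (- x) ^ j = ((- 1) ^ j * (- 1) ^ j) * (coeff (det P) j * x ^ j)"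
      unfolding dc power_minus[of x] by (simp only: mult_ac)
    then show "coeff (det P) j * x ^ j = det_coeff N j * (- x) ^ j"
      by (simp only: minus_one_mult_self mult_1_left)
  qed simp
  finally show "det (N - x \<cdot>\<^sub>m 1\<^sub>m p) = (\<Sum>j\<le>p. det_coeff N j * (- x) ^ j)" .
qed

definition proj_out_col :: "real mat \<Rightarrow> nat \<Rightarrow> real mat" where
  "proj_out_col B i =
     (1\<^sub>m (dim_row B) -
        (1 / (col B i \<bullet> col B i)) \<cdot>\<^sub>m
          mat (dim_row B) (dim_row B) (\<lambda>(r, s). col B i $ r * col B i $ s)) * B"

definition css_ratio :: "real mat \<Rightarrow> nat \<Rightarrow> nat \<Rightarrow> nat \<Rightarrow> real" where
  "css_ratio B k t i =
     (let p = dim_row B; G = proj_out_col B i * transpose_mat (proj_out_col B i)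
      in det_coeff G (p - k + t - 1) / det_coeff G (p - k + t))"

text \<open>\<open>css_state M k S B\<close>: after \<open>length S\<close> iterations the algorithm may hold \<open>S\<close> and \<open>B\<close>;
  ties in the minimization may be resolved in any way.\<close>

inductive css_state :: "real mat \<Rightarrow> nat \<Rightarrow> nat list \<Rightarrow> real mat \<Rightarrow> bool" for M k where
  init: "css_state M k [] M"
| step: "css_state M k (S @ [i])
           (M - cols_sub M (S @ [i]) * pinv (cols_sub M (S @ [i])) * M)"
  if "css_state M k S B" and "length S < k"
    and "is_arg_min (css_ratio B k (length S + 1))
           (\<lambda>i. i < dim_col M \<and> col B i \<noteq> 0\<^sub>v (dim_row M)) i"

definition css_output :: "real mat \<Rightarrow> nat \<Rightarrow> nat list \<Rightarrow> bool" where
  "css_output M k S \<longleftrightarrow> length S = k \<and> (\<exists>B. css_state M k S B)"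

end

theory Submission
  imports Defs
begin

text \<open>Write \<open>e_j(B)\<close> for the sum of the principal minors of order \<open>j\<close> of \<open>B\<^sup>T B\<close>, which is a coefficient
  of the characteristic polynomial of both \<open>B\<^sup>T B\<close> and \<open>B B\<^sup>T\<close>; in particular \<open>e_1(B)\<close> is the squared
  Frobenius norm. If \<open>B_i\<close> arises from \<open>B\<close> by projecting out the column \<open>b_i\<close>, then
  \<open>\<Sum>\<^sub>i \<parallel>b_i\<parallel>\<^sup>2 e_j(B_i) = (j + 1) e_(j+1)(B)\<close>. Averaging shows that in step \<open>t\<close> the minimal ratio
  \<open>e_(k-t+1) / e_(k-t)\<close> is at most \<open>(k - t + 2) / (k - t + 1)\<close> times the ratio of the step before, and
  the product telescopes: the final residual has squared norm at most
  \<open>(k + 1) e_(k+1)(M) / e_k(M)\<close>. By Fischer's inequality \<open>e_(k+1)(M) / e_k(M) \<le> \<parallel>M - X\<parallel>\<^sup>2\<close> for every \<open>X\<close>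
  of rank at most \<open>k\<close>. Finally, the three errors of the orthogonal projections onto the spans of the
  chosen fibres add up by the Pythagorean theorem.\<close>

section \<open>Principal minors\<close>

text \<open>Replacing the rows outside \<open>T\<close> by unit vectors gives the minor on \<open>T\<close> without reindexing
  the submatrix.\<close>

definition principal_minor :: "real mat \<Rightarrow> nat set \<Rightarrow> real" where
  "principal_minor H T = det (mat (dim_row H) (dim_row H)
     (\<lambda>(i, j). if i \<in> T then H $$ (i, j) else if i = j then 1 else 0))"

text \<open>For square \<open>H\<close> this is the elementary symmetric polynomial of degree
  \<open>j\<close> in the eigenvalues, written without eigenvalues as a sum over index sets.\<close>

definition minor_sum :: "real mat \<Rightarrow> nat \<Rightarrow> real" where
  "minor_sum H j = (\<Sum>T | T \<subseteq> {..<dim_row H} \<and> card T = j. principal_minor H T)"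

lemma principal_minor_empty [simp]: "principal_minor H {} = 1"
proof -
  have "mat (dim_row H) (dim_row H) (\<lambda>(i, j). if i = j then 1 else 0 :: real) = 1\<^sub>m (dim_row H)"
    by (rule eq_matI) auto
  then show ?thesis by (simp add: principal_minor_def)
qed

lemma minor_sum_0 [simp]: "minor_sum H 0 = 1"
proof -
  have "{T. T \<subseteq> {..<dim_row H} \<and> card T = 0} = {{}}"
    by (auto dest: finite_subset)
  then show ?thesis unfolding minor_sum_def by simp
qed

lemma minor_sum_eq_0: "dim_row H < j \<Longrightarrow> minor_sum H j = 0"
  unfolding minor_sum_def
  by (intro sum.neutral) (auto dest: card_mono[OF finite_lessThan])

lemma principal_minor_zero_row:
  assumes "i \<in> T" "i < dim_row H" "\<And>j. j < dim_row H \<Longrightarrow> H $$ (i, j) = 0"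
  shows "principal_minor H T = 0"
  unfolding principal_minor_def
proof (subst det_def', rule mat_carrier, intro sum.neutral ballI)
  fix \<sigma> assume "\<sigma> \<in> {\<sigma>. \<sigma> permutes {0..<dim_row H}}"
  then have "\<sigma> i < dim_row H" using assms permutes_in_image[of \<sigma> "{0..<dim_row H}" i] by auto
  then have "(\<Prod>l = 0..<dim_row H. mat (dim_row H) (dim_row H)
      (\<lambda>(i, j). if i \<in> T then H $$ (i, j) else if i = j then 1 else 0) $$ (l, \<sigma> l)) = 0"
    using assms by (intro prod_zero) (auto intro!: bexI[of _ i])
  then show "signof \<sigma> * (\<Prod>l = 0..<dim_row H. mat (dim_row H) (dim_row H)
      (\<lambda>(i, j). if i \<in> T then H $$ (i, j) else if i = j then 1 else 0) $$ (l, \<sigma> l)) = 0"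
    by simp
qed

lemma permutes_eq_id_if_fixes_all_but_one:
  assumes p: "\<sigma> permutes A" and fixed: "\<And>j. j \<in> A \<Longrightarrow> j \<noteq> i \<Longrightarrow> \<sigma> j = j"
  shows "\<sigma> = id"
proof -
  have fixed': "\<sigma> j = j" if "j \<noteq> i" for j
    using fixed[of j] p that by (cases "j \<in> A") (auto simp: permutes_def)
  have "\<sigma> i = i"
  proof (rule ccontr)
    assume "\<sigma> i \<noteq> i"
    then have "\<sigma> (\<sigma> i) = \<sigma> i" by (rule fixed')
    with permutes_inj[OF p] \<open>\<sigma> i \<noteq> i\<close> show False by (auto dest: injD)
  qed
  with fixed' show ?thesis by (metis eq_id_iff)
qed

text \<open>Every row except row \<open>i\<close> is a unit vector, so a permutation with a nonzero
  Leibniz product fixes all points other than \<open>i\<close> and is the identity.\<close>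

lemma principal_minor_singleton:
  assumes i: "i < dim_row H"
  shows "principal_minor H {i} = H $$ (i, i)"
proof -
  let ?n = "dim_row H"
  let ?M = "mat ?n ?n (\<lambda>(a, b). if a \<in> {i} then H $$ (a, b) else if a = b then 1 else 0 :: real)"
  have "det ?M = (\<Sum>\<sigma> | \<sigma> permutes {0..<?n}. signof \<sigma> * (\<Prod>l = 0..<?n. ?M $$ (l, \<sigma> l)))"
    by (rule det_def') simp
  also have "\<dots> = (\<Sum>\<sigma> | \<sigma> permutes {0..<?n}. if \<sigma> = id then H $$ (i, i) else 0)"
  proof (rule sum.cong, rule refl)
    fix \<sigma> assume "\<sigma> \<in> {\<sigma>. \<sigma> permutes {0..<?n}}"
    then have \<sigma>: "\<sigma> permutes {0..<?n}" by simp
    show "signof \<sigma> * (\<Prod>l = 0..<?n. ?M $$ (l, \<sigma> l)) = (if \<sigma> = id then H $$ (i, i) else 0)"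
    proof (cases "\<sigma> = id")
      case True
      have "(\<Prod>l = 0..<?n. ?M $$ (l, l)) = (\<Prod>l = 0..<?n. if l = i then H $$ (i, i) else 1)"
        by (rule prod.cong) auto
      also have "\<dots> = H $$ (i, i)" using i by (subst prod.delta) auto
      finally show ?thesis using True by simp
    next
      case False
      then obtain l where l: "l \<in> {0..<?n}" "l \<noteq> i" "\<sigma> l \<noteq> l"
        using permutes_eq_id_if_fixes_all_but_one[OF \<sigma>] by metis
      moreover have "\<sigma> l < ?n" using l \<sigma> permutes_in_image[of \<sigma> "{0..<?n}" l] by auto
      ultimately have "(\<Prod>l = 0..<?n. ?M $$ (l, \<sigma> l)) = 0"
        by (intro prod_zero) (auto intro!: bexI[of _ l])
      then show ?thesis using False by simp
    qed
  qed
  also have "\<dots> = H $$ (i, i)"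
    by (subst sum.delta) (auto simp: finite_permutations permutes_id)
  finally show ?thesis by (simp add: principal_minor_def)
qed

text \<open>Expand each Leibniz product by distributivity: \<open>T\<close> collects the positions
  whose factor comes from \<open>H\<close>. At the other positions the factor is \<open>y\<close>
  and \<sigma> must fix the position, which is the effect of the unit rows in
  \<open>principal_minor\<close>.\<close>

lemma det_add_scalar:
  assumes H: "H \<in> carrier_mat n n"
  shows "det (H + y \<cdot>\<^sub>m 1\<^sub>m n) = (\<Sum>T\<in>Pow {..<n}. y ^ (n - card T) * principal_minor H T)"
proof -
  let ?N = "{0..<n}"
  let ?m = "\<lambda>T i j. if i \<in> T then H $$ (i, j) else if i = j then 1 else 0"
  have pm: "principal_minor H T = (\<Sum>\<sigma> | \<sigma> permutes ?N. signof \<sigma> * (\<Prod>i\<in>?N. ?m T i (\<sigma> i)))" for T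
  proof -
    have "(\<Prod>i = 0..<n. mat n n (\<lambda>(i, j). ?m T i j) $$ (i, \<sigma> i)) = (\<Prod>i\<in>?N. ?m T i (\<sigma> i))"
      if "\<sigma> permutes ?N" for \<sigma>
      using permutes_in_image[OF that] by (intro prod.cong) auto
    then show ?thesis using H unfolding principal_minor_def by (subst det_def'[of _ n]) auto
  qed
  have prod: "(\<Prod>i\<in>?N. (H + y \<cdot>\<^sub>m 1\<^sub>m n) $$ (i, \<sigma> i))
      = (\<Sum>T\<in>Pow ?N. y ^ (n - card T) * (\<Prod>i\<in>?N. ?m T i (\<sigma> i)))" if \<sigma>: "\<sigma> permutes ?N" for \<sigma>
  proof -
    have "(\<Prod>i\<in>?N. (H + y \<cdot>\<^sub>m 1\<^sub>m n) $$ (i, \<sigma> i))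
        = (\<Prod>i\<in>?N. H $$ (i, \<sigma> i) + y * (if i = \<sigma> i then 1 else 0))"
      using H permutes_in_image[OF \<sigma>] by (intro prod.cong) auto
    also have "\<dots> = (\<Sum>T\<in>Pow ?N. (\<Prod>i\<in>T. H $$ (i, \<sigma> i))
        * (\<Prod>i\<in>?N - T. y * (if i = \<sigma> i then 1 else 0)))"
      by (rule prod_add) simp
    also have "\<dots> = (\<Sum>T\<in>Pow ?N. y ^ (n - card T) * (\<Prod>i\<in>?N. ?m T i (\<sigma> i)))"
    proof (rule sum.cong, rule refl)
      fix T assume "T \<in> Pow ?N"
      then have T: "T \<subseteq> ?N" "finite T" by (auto intro: finite_subset)
      have "(\<Prod>i\<in>?N. ?m T i (\<sigma> i)) = (\<Prod>i\<in>T. ?m T i (\<sigma> i)) * (\<Prod>i\<in>?N - T. ?m T i (\<sigma> i))"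
        using T by (simp add: prod.subset_diff)
      also have "(\<Prod>i\<in>T. ?m T i (\<sigma> i)) = (\<Prod>i\<in>T. H $$ (i, \<sigma> i))" by (rule prod.cong) auto
      also have "(\<Prod>i\<in>?N - T. ?m T i (\<sigma> i)) = (\<Prod>i\<in>?N - T. if i = \<sigma> i then 1 else 0)"
        by (rule prod.cong) auto
      finally show "(\<Prod>i\<in>T. H $$ (i, \<sigma> i)) * (\<Prod>i\<in>?N - T. y * (if i = \<sigma> i then 1 else 0))
          = y ^ (n - card T) * (\<Prod>i\<in>?N. ?m T i (\<sigma> i))"
        using T unfolding prod.distrib by (simp add: card_Diff_subset)
    qed
    finally show ?thesis .
  qed
  have "det (H + y \<cdot>\<^sub>m 1\<^sub>m n)
      = (\<Sum>\<sigma> | \<sigma> permutes ?N. signof \<sigma> * (\<Prod>i\<in>?N. (H + y \<cdot>\<^sub>m 1\<^sub>m n) $$ (i, \<sigma> i)))"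
    using H by (intro det_def') simp
  also have "\<dots> = (\<Sum>\<sigma> | \<sigma> permutes ?N. \<Sum>T\<in>Pow ?N.
      y ^ (n - card T) * (signof \<sigma> * (\<Prod>i\<in>?N. ?m T i (\<sigma> i))))"
    by (rule sum.cong, rule refl, subst prod) (simp_all add: sum_distrib_left mult_ac)
  also have "\<dots> = (\<Sum>T\<in>Pow ?N. y ^ (n - card T) * principal_minor H T)"
    unfolding pm sum_distrib_left by (rule sum.swap)
  finally show ?thesis by (simp add: lessThan_atLeast0)
qed

text \<open>The factor \<open>y ^ m\<close> pads the polynomial to degree \<open>n + m\<close>, so
  that Gram matrices of different sizes can be compared coefficient by coefficient.\<close>

lemma det_add_scalar_minor_sum:
  assumes H: "H \<in> carrier_mat n n"
  shows "y ^ m * det (H + y \<cdot>\<^sub>m 1\<^sub>m n) = (\<Sum>i\<le>n + m. minor_sum H (n + m - i) * y ^ i)"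
proof -
  have "det (H + y \<cdot>\<^sub>m 1\<^sub>m n)
      = (\<Sum>j\<le>n. \<Sum>T | T \<in> Pow {..<n} \<and> card T = j. y ^ (n - card T) * principal_minor H T)"
    unfolding det_add_scalar[OF H]
    by (rule sum.group[symmetric]) (use card_mono[of "{..<n}"] in auto)
  also have "\<dots> = (\<Sum>j\<le>n. minor_sum H j * y ^ (n - j))"
    using H by (auto simp: minor_sum_def sum_distrib_left mult.commute[of _ "y ^ _"] intro!: sum.cong)
  finally have "y ^ m * det (H + y \<cdot>\<^sub>m 1\<^sub>m n) = (\<Sum>j\<le>n. minor_sum H j * y ^ (n + m - j))"
    by (auto simp: sum_distrib_left power_add[symmetric] mult_ac add.commute[of m n] intro!: sum.cong)
  also have "\<dots> = (\<Sum>j\<le>n + m. minor_sum H j * y ^ (n + m - j))"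
    using H by (intro sum.mono_neutral_left) (auto simp: minor_sum_eq_0)
  also have "\<dots> = (\<Sum>i\<le>n + m. minor_sum H (n + m - i) * y ^ i)"
    by (rule sum.reindex_bij_witness[of _ "\<lambda>i. n + m - i" "\<lambda>i. n + m - i"]) auto
  finally show ?thesis .
qed

text \<open>Both sides are coefficients of the determinant of
  \<open>H + y \<cdot>\<^sub>m 1\<^sub>m n\<close> as a polynomial in \<open>y\<close>, and
  agreement at every real \<open>y\<close> identifies them. This turns the quantities of the
  algorithm into sums of minors.\<close>

lemma det_coeff_eq_minor_sum:
  assumes H: "H \<in> carrier_mat n n" and j: "j \<le> n"
  shows "det_coeff H (n - j) = minor_sum H j"
proof -
  have "(\<Sum>i\<le>n. det_coeff H i * y ^ i) = (\<Sum>i\<le>n. minor_sum H (n - i) * y ^ i)" for y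
  proof -
    have "H - (- y) \<cdot>\<^sub>m 1\<^sub>m n = H + y \<cdot>\<^sub>m 1\<^sub>m n"
      using H by (intro eq_matI) auto
    then show ?thesis
      using det_minus_scalar_eq_det_coeff(1)[OF H, of "- y"] det_add_scalar_minor_sum[OF H, of y 0]
      by simp
  qed
  then have "\<forall>i\<le>n. det_coeff H i = minor_sum H (n - i)"
    unfolding polyfun_eq_coeffs[symmetric] by (rule allI)
  with j show ?thesis by simp
qed

text \<open>Evaluate the determinant of the block matrix \<open>[1, -B; B\<^sup>T, y]\<close> by clearing either off-diagonal block.\<close>

lemma det_mult_transpose_add_scalar:
  fixes B :: "real mat"
  assumes B: "B \<in> carrier_mat p q"
  shows "y ^ q * det (B * transpose_mat B + y \<cdot>\<^sub>m 1\<^sub>m p)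
       = y ^ p * det (transpose_mat B * B + y \<cdot>\<^sub>m 1\<^sub>m q)"
proof -
  define Z where "Z = four_block_mat (1\<^sub>m p) (- B) (transpose_mat B) (y \<cdot>\<^sub>m 1\<^sub>m q)"
  \<comment> \<open>Both \<open>Z * R\<close> and \<open>L * Z\<close> have a zero upper right
    block. Putting \<open>y\<close> into \<open>L\<close>, instead of dividing by it, keeps the
    argument valid at \<open>y = 0\<close> and yields the factor
    \<open>det L = y ^ p\<close>.\<close>
  define R where "R = four_block_mat (1\<^sub>m p) B (0\<^sub>m q p) (1\<^sub>m q)"
  define L where "L = four_block_mat (y \<cdot>\<^sub>m 1\<^sub>m p) B (0\<^sub>m q p) (1\<^sub>m q)"
  have BT: "transpose_mat B \<in> carrier_mat q p" using B by simp
  have c: "Z \<in> carrier_mat (p + q) (p + q)" "R \<in> carrier_mat (p + q) (p + q)"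
      "L \<in> carrier_mat (p + q) (p + q)"
    using B unfolding Z_def R_def L_def by auto
  have "Z * R = four_block_mat (1\<^sub>m p) (0\<^sub>m p q) (transpose_mat B)
      (transpose_mat B * B + y \<cdot>\<^sub>m 1\<^sub>m q)"
    unfolding Z_def R_def using B BT
    by (subst mult_four_block_mat[where ?nr1.0 = p and ?n1.0 = p and ?n2.0 = q and ?nr2.0 = q
          and ?nc1.0 = p and ?nc2.0 = q]) (auto intro!: cong_four_block_mat)
  then have 1: "det (Z * R) = det (transpose_mat B * B + y \<cdot>\<^sub>m 1\<^sub>m q)"
    using B BT by (simp add: det_four_block_mat_upper_right_zero[of _ p _ q])
  have e1: "y \<cdot>\<^sub>m 1\<^sub>m p * 1\<^sub>m p + B * transpose_mat B = B * transpose_mat B + y \<cdot>\<^sub>m 1\<^sub>m p"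
    using B BT by (simp add: comm_add_mat[of "B * transpose_mat B" p p])
  have e2: "y \<cdot>\<^sub>m 1\<^sub>m p * (- B) + B * (y \<cdot>\<^sub>m 1\<^sub>m q) = 0\<^sub>m p q"
  proof -
    have "y \<cdot>\<^sub>m 1\<^sub>m p * (- B) = y \<cdot>\<^sub>m (- B)" "B * (y \<cdot>\<^sub>m 1\<^sub>m q) = y \<cdot>\<^sub>m B"
      using B mult_smult_assoc_mat[of "1\<^sub>m p" p p "- B" q y] mult_smult_distrib[of B p q "1\<^sub>m q" q y]
      by auto
    with B show ?thesis by (auto intro!: eq_matI)
  qed
  have "L * Z = four_block_mat (y \<cdot>\<^sub>m 1\<^sub>m p * 1\<^sub>m p + B * transpose_mat B)
      (y \<cdot>\<^sub>m 1\<^sub>m p * (- B) + B * (y \<cdot>\<^sub>m 1\<^sub>m q))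
      (0\<^sub>m q p * 1\<^sub>m p + 1\<^sub>m q * transpose_mat B) (0\<^sub>m q p * (- B) + 1\<^sub>m q * (y \<cdot>\<^sub>m 1\<^sub>m q))"
    unfolding Z_def L_def
    by (rule mult_four_block_mat[of _ p p _ q _ q _ _ p _ q]) (use B BT in simp_all)
  also have "\<dots> = four_block_mat (B * transpose_mat B + y \<cdot>\<^sub>m 1\<^sub>m p) (0\<^sub>m p q)
      (transpose_mat B) (y \<cdot>\<^sub>m 1\<^sub>m q)"
    unfolding e1 e2 left_mult_zero_mat[OF uminus_carrier_mat[OF B]] using B BT by simp
  finally have "L * Z = four_block_mat (B * transpose_mat B + y \<cdot>\<^sub>m 1\<^sub>m p) (0\<^sub>m p q)
      (transpose_mat B) (y \<cdot>\<^sub>m 1\<^sub>m q)" .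
  then have 2: "det (L * Z) = det (B * transpose_mat B + y \<cdot>\<^sub>m 1\<^sub>m p) * y ^ q"
    using B BT by (simp add: det_four_block_mat_upper_right_zero[of _ p _ q])
  have "det R = 1" "det L = y ^ p"
    using B unfolding R_def L_def by (simp_all add: det_four_block_mat_lower_left_zero[of _ p _ q])
  moreover have "det Z * det R = det (transpose_mat B * B + y \<cdot>\<^sub>m 1\<^sub>m q)"
    "det L * det Z = det (B * transpose_mat B + y \<cdot>\<^sub>m 1\<^sub>m p) * y ^ q"
    using 1 2 det_mult[OF c(1,2)] det_mult[OF c(3,1)] by metis+
  ultimately show ?thesis by (metis mult.commute mult_1_right)
qed

text \<open>The algorithm works with \<open>B * transpose_mat B\<close>, while index sets of columns
  belong to the other product. The two determinants, padded to the common degree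
  \<open>p + q\<close>, are the same polynomial; for larger \<open>j\<close> both sums are
  empty.\<close>

lemma minor_sum_mult_transpose:
  assumes B: "B \<in> carrier_mat p q"
  shows "minor_sum (B * transpose_mat B) j = minor_sum (transpose_mat B * B) j"
proof (cases "j \<le> p + q")
  case True
  have c: "B * transpose_mat B \<in> carrier_mat p p" "transpose_mat B * B \<in> carrier_mat q q"
    using B by auto
  have "(\<Sum>i\<le>p + q. minor_sum (B * transpose_mat B) (p + q - i) * y ^ i)
      = (\<Sum>i\<le>p + q. minor_sum (transpose_mat B * B) (p + q - i) * y ^ i)" for y
    unfolding det_add_scalar_minor_sum[OF c(1), symmetric] det_mult_transpose_add_scalar[OF B]
      det_add_scalar_minor_sum[OF c(2)] by (simp only: add.commute[of q p])
  then have "\<forall>i\<le>p + q. minor_sum (B * transpose_mat B) (p + q - i)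
      = minor_sum (transpose_mat B * B) (p + q - i)"
    unfolding polyfun_eq_coeffs[symmetric] by (rule allI)
  from this[rule_format, of "p + q - j"] True show ?thesis by simp
next
  case False
  then show ?thesis using B by (simp add: minor_sum_eq_0)
qed

section \<open>Gram matrices\<close>

lemma scalar_prod_self: "v \<bullet> v = (\<Sum>i<dim_vec v. (v $ i)\<^sup>2)" for v :: "real vec"
  by (simp add: scalar_prod_def power2_eq_square lessThan_atLeast0)

lemma scalar_prod_self_nonneg [simp]: "0 \<le> v \<bullet> v" for v :: "real vec"
  unfolding scalar_prod_self by (simp add: sum_nonneg)

lemma scalar_prod_self_eq_0_iff: "v \<bullet> v = 0 \<longleftrightarrow> v = 0\<^sub>v (dim_vec v)" for v :: "real vec"
  unfolding scalar_prod_self by (subst sum_nonneg_eq_0_iff) (auto simp: vec_eq_iff)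

lemma scalar_prod_self_pos: "v \<in> carrier_vec n \<Longrightarrow> v \<noteq> 0\<^sub>v n \<Longrightarrow> 0 < v \<bullet> v" for v :: "real vec"
  using scalar_prod_self_eq_0_iff[of v] scalar_prod_self_nonneg[of v]
  by (metis carrier_vecD order_le_less)

abbreviation gram :: "real mat \<Rightarrow> real mat" where
  "gram B \<equiv> transpose_mat B * B"

lemma gram_index:
  "i < dim_col B \<Longrightarrow> j < dim_col B \<Longrightarrow> gram B $$ (i, j) = col B i \<bullet> col B j"
  by simp

section \<open>Projecting out one column\<close>

lemma dim_proj_out_col [simp]:
  "dim_row (proj_out_col B i) = dim_row B" "dim_col (proj_out_col B i) = dim_col B"
  by (simp_all add: proj_out_col_def)

text \<open>This also holds for a zero column \<open>i\<close>, where division by 0 makes \<open>proj_out_col B i = B\<close>.\<close>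

lemma proj_out_col_index:
  assumes "r < dim_row B" "s < dim_col B"
  shows "proj_out_col B i $$ (r, s)
    = B $$ (r, s) - (col B i \<bullet> col B s) / (col B i \<bullet> col B i) * col B i $ r"
proof -
  let ?b = "col B i" and ?p = "dim_row B"
  define P where "P = mat ?p ?p (\<lambda>(r, s). ?b $ r * ?b $ s)"
  have P: "P \<in> carrier_mat ?p ?p" by (simp add: P_def)
  have "(P * B) $$ (r, s) = ?b $ r * (?b \<bullet> col B s)"
    using assms by (simp add: P_def scalar_prod_def sum_distrib_left mult.assoc)
  moreover have "proj_out_col B i = B - (1 / (?b \<bullet> ?b)) \<cdot>\<^sub>m (P * B)"
    unfolding proj_out_col_def P_def[symmetric]
    using P by (subst minus_mult_distrib_mat[of _ ?p ?p _ _ "dim_col B"])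
      (auto simp: mult_smult_assoc_mat[of _ ?p ?p _ "dim_col B"])
  ultimately show ?thesis using assms P by simp
qed

lemma col_proj_out_col:
  assumes "s < dim_col B"
  shows "col (proj_out_col B i) s
    = col B s - ((col B i \<bullet> col B s) / (col B i \<bullet> col B i)) \<cdot>\<^sub>v col B i"
  using assms by (intro eq_vecI) (auto simp: proj_out_col_index)

text \<open>This is the Schur complement of \<open>gram B\<close> at \<open>(i, i)\<close>. For a
  zero column \<open>i\<close> the subtracted term is 0 by the convention
  \<open>x / 0 = 0\<close>.\<close>

lemma gram_proj_out_col:
  assumes "a < dim_col B" "b < dim_col B"
  shows "gram (proj_out_col B i) $$ (a, b)
    = gram B $$ (a, b) - (col B a \<bullet> col B i) * (col B i \<bullet> col B b) / (col B i \<bullet> col B i)"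
proof -
  let ?p = "dim_row B"
  have "gram (proj_out_col B i) $$ (a, b)
      = (\<Sum>r = 0..<?p. (col B a $ r - (col B i \<bullet> col B a) / (col B i \<bullet> col B i) * col B i $ r)
          * (col B b $ r - (col B i \<bullet> col B b) / (col B i \<bullet> col B i) * col B i $ r))"
    using assms by (simp add: col_proj_out_col scalar_prod_def)
  also have "\<dots> = col B a \<bullet> col B b
      - (col B i \<bullet> col B b) / (col B i \<bullet> col B i) * (col B a \<bullet> col B i)
      - (col B i \<bullet> col B a) / (col B i \<bullet> col B i) * (col B i \<bullet> col B b)
      + (col B i \<bullet> col B a) / (col B i \<bullet> col B i) * ((col B i \<bullet> col B b) / (col B i \<bullet> col B i))
          * (col B i \<bullet> col B i)"
    unfolding scalar_prod_def dim_col sum_distrib_left sum_subtractf[symmetric] sum.distrib[symmetric]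
    by (rule sum.cong) (auto simp: algebra_simps)
  also have "\<dots> = gram B $$ (a, b)
      - (col B a \<bullet> col B i) * (col B i \<bullet> col B b) / (col B i \<bullet> col B i)"
    using assms comm_scalar_prod[of "col B i" ?p "col B a"] by (simp add: field_simps)
  finally show ?thesis .
qed

text \<open>Pivoting on \<open>(i, i)\<close>, written as the factorization \<open>V\<^sup>T * M K T * M H {i}\<close>, where \<open>K\<close> is the
  Schur complement.\<close>

lemma principal_minor_insert:
  assumes H: "H \<in> carrier_mat n n" and i: "i < n" and "H $$ (i, i) \<noteq> 0"
    and "T \<subseteq> {..<n}" "i \<notin> T"
  shows "principal_minor H (insert i T) = H $$ (i, i) *
    principal_minor (mat n n (\<lambda>(a, b). H $$ (a, b) - H $$ (a, i) * H $$ (i, b) / H $$ (i, i))) T"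
proof -
  define K where "K = mat n n (\<lambda>(a, b). H $$ (a, b) - H $$ (a, i) * H $$ (i, b) / H $$ (i, i))"
  define M where "M = (\<lambda>N S. mat n n (\<lambda>(a, b). if a \<in> S then N $$ (a, b) else if a = b then 1 else 0 :: real))"
  \<comment> \<open>\<open>w\<close> holds the elimination multipliers: multiplication by
    \<open>transpose_mat V\<close> from the left adds \<open>w a\<close> times row \<open>i\<close>
    to row \<open>a\<close>, which undoes the elimination that produced \<open>K\<close>.\<close>
  define w where "w = (\<lambda>a. if a \<in> T then H $$ (a, i) / H $$ (i, i) else 0)"
  define V where "V = mat n n (\<lambda>(a, b). (if a = b then 1 else 0) + (if a = i then w b else 0))"
  have pm: "principal_minor N S = det (M N S)" if "N \<in> carrier_mat n n" for N S
    using that by (simp add: principal_minor_def M_def)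
  have K: "K \<in> carrier_mat n n" and V: "V \<in> carrier_mat n n"
    and M: "M N S \<in> carrier_mat n n" for N S
    by (simp_all add: K_def V_def M_def)
  have MV: "M V {i} = V" by (rule eq_matI) (auto simp: M_def V_def)
  have "V $$ (i, i) = 1" using i assms by (simp add: V_def w_def)
  then have detV: "det (transpose_mat V) = 1"
    using pm[OF V, of "{i}"] principal_minor_singleton[of i V] i V
    by (simp add: MV det_transpose[OF V])
  have detR: "det (M H {i}) = H $$ (i, i)"
    using pm[OF H, of "{i}"] principal_minor_singleton[of i H] i H by simp
  \<comment> \<open>Column \<open>i\<close> of \<open>K\<close> is zero, so the right-hand factor
    affects only row \<open>i\<close>, a unit vector that is replaced by row \<open>i\<close> of
    \<open>H\<close>.\<close>
  have "M K T * M H {i} = mat n n (\<lambda>(a, c). if a = i then H $$ (i, c) else M K T $$ (a, c))"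
  proof (rule eq_matI)
    fix a c assume "a < dim_row (mat n n (\<lambda>(a, c). if a = i then H $$ (i, c) else M K T $$ (a, c)))"
      "c < dim_col (mat n n (\<lambda>(a, c). if a = i then H $$ (i, c) else M K T $$ (a, c)))"
    then have ac: "a < n" "c < n" by auto
    have "(M K T * M H {i}) $$ (a, c) = (\<Sum>b = 0..<n. M K T $$ (a, b) * M H {i} $$ (b, c))"
      using ac by (simp add: M_def scalar_prod_def)
    also have "\<dots> = (\<Sum>b = 0..<n. (if b = c then M K T $$ (a, c) else 0)
        + (if b = i then M K T $$ (a, i) * (H $$ (i, c) - (if i = c then 1 else 0)) else 0))"
      using ac i by (intro sum.cong) (auto simp: M_def algebra_simps)
    also have "\<dots> = M K T $$ (a, c) + M K T $$ (a, i) * (H $$ (i, c) - (if i = c then 1 else 0))"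
      using ac i by (simp add: sum.distrib)
    also have "\<dots> = (if a = i then H $$ (i, c) else M K T $$ (a, c))"
      using ac i assms by (auto simp: M_def K_def)
    finally show "(M K T * M H {i}) $$ (a, c)
        = mat n n (\<lambda>(a, c). if a = i then H $$ (i, c) else M K T $$ (a, c)) $$ (a, c)"
      using ac by simp
  qed (auto simp: M_def)
  moreover define X where "X = mat n n (\<lambda>(a, c). if a = i then H $$ (i, c) else M K T $$ (a, c))"
  ultimately have MX: "M K T * M H {i} = X" by simp
  have X: "X \<in> carrier_mat n n" by (simp add: X_def)
  have "transpose_mat V * X = M H (insert i T)"
  proof (rule eq_matI)
    fix a c assume "a < dim_row (M H (insert i T))" "c < dim_col (M H (insert i T))"
    then have ac: "a < n" "c < n" by (auto simp: M_def)
    have "(transpose_mat V * X) $$ (a, c) = (\<Sum>b = 0..<n. V $$ (b, a) * X $$ (b, c))"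
      using ac V X by (simp add: scalar_prod_def)
    also have "\<dots> = (\<Sum>b = 0..<n. (if b = a then X $$ (a, c) else 0)
        + (if b = i then w a * X $$ (i, c) else 0))"
      using ac i by (intro sum.cong) (auto simp: V_def algebra_simps)
    also have "\<dots> = X $$ (a, c) + w a * X $$ (i, c)"
      using ac i by (simp add: sum.distrib)
    also have "\<dots> = M H (insert i T) $$ (a, c)"
      using ac i assms by (auto simp: X_def M_def K_def w_def)
    finally show "(transpose_mat V * X) $$ (a, c) = M H (insert i T) $$ (a, c)" .
  qed (use V X in \<open>auto simp: M_def\<close>)
  then have "det (M H (insert i T)) = det (transpose_mat V) * (det (M K T) * det (M H {i}))"
    using det_mult[of "transpose_mat V" n X] det_mult[OF M M, of K T H "{i}"] V X MX by simp
  then show ?thesis using pm[OF H] pm[OF K] detV detR by (simp add: K_def)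
qed

text \<open>The minor on an index set is the squared volume spanned by those columns; column
  \<open>i\<close> is one side, and projecting it out leaves the heights of the others over it. If
  column \<open>i\<close> is zero, the Gram matrix has a zero row and both sides vanish.\<close>

lemma principal_minor_gram_insert:
  assumes i: "i < dim_col B" and T: "T \<subseteq> {..<dim_col B}" "i \<notin> T"
  shows "principal_minor (gram B) (insert i T)
    = (col B i \<bullet> col B i) * principal_minor (gram (proj_out_col B i)) T"
proof (cases "col B i \<bullet> col B i = 0")
  case True
  then have "col B i = 0\<^sub>v (dim_row B)" by (simp add: scalar_prod_self_eq_0_iff)
  then have "principal_minor (gram B) (insert i T) = 0"
    using i by (intro principal_minor_zero_row[of i]) auto
  with True show ?thesis by simp
next
  case False
  have "mat (dim_col B) (dim_col B) (\<lambda>(a, b). gram B $$ (a, b)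
      - gram B $$ (a, i) * gram B $$ (i, b) / gram B $$ (i, i)) = gram (proj_out_col B i)"
    by (rule eq_matI) (use i in \<open>auto simp: gram_proj_out_col simp del: index_mult_mat(1)\<close>,
      simp add: gram_index del: index_mult_mat(1))
  moreover have "gram B \<in> carrier_mat (dim_col B) (dim_col B)"
    by (rule carrier_matI) auto
  ultimately show ?thesis
    using principal_minor_insert[of "gram B" "dim_col B" i T] assms False by simp
qed

text \<open>Peeling off one column at a time leaves a product of squared lengths. The remaining
  minor belongs to a projected matrix, hence the induction with \<open>B\<close> arbitrary.\<close>

lemma principal_minor_gram_nonneg:
  assumes "T \<subseteq> {..<dim_col B}"
  shows "0 \<le> principal_minor (gram B) T"
proof -
  have "finite T" using assms by (rule finite_subset) simp
  then show ?thesis using assms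
  proof (induction T arbitrary: B rule: finite_induct)
    case (insert i T)
    then show ?case by (simp add: principal_minor_gram_insert)
  qed simp
qed

lemma minor_sum_gram_nonneg: "0 \<le> minor_sum (gram B) j"
  unfolding minor_sum_def by (intro sum_nonneg principal_minor_gram_nonneg) simp

text \<open>Fischer's inequality for splitting off one column. Peel off the columns of
  \<open>T\<close>; each projection can only shorten column \<open>i\<close>.\<close>

lemma principal_minor_gram_insert_le:
  assumes "i < dim_col B" "T \<subseteq> {..<dim_col B}" "i \<notin> T"
  shows "principal_minor (gram B) (insert i T) \<le> (col B i \<bullet> col B i) * principal_minor (gram B) T"
proof -
  have "finite T" using assms(2) by (rule finite_subset) simp
  then show ?thesis using assms
  proof (induction T arbitrary: B rule: finite_induct)
    case empty
    then show ?case by (simp add: principal_minor_singleton)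
  next
    case (insert l T)
    let ?P = "proj_out_col B l"
    have il: "i \<noteq> l" "i \<notin> T" using insert by auto
    have "col ?P i \<bullet> col ?P i = col B i \<bullet> col B i - (col B i \<bullet> col B l)\<^sup>2 / (col B l \<bullet> col B l)"
      using gram_proj_out_col[of i B i l] insert.prems comm_scalar_prod[of "col B i" "dim_row B" "col B l"]
      by (simp add: power2_eq_square)
    then have le: "col ?P i \<bullet> col ?P i \<le> col B i \<bullet> col B i" by simp
    have "principal_minor (gram B) (insert i (insert l T))
        = (col B l \<bullet> col B l) * principal_minor (gram ?P) (insert i T)"
      using principal_minor_gram_insert[of l B "insert i T"] insert il by (simp add: insert_commute)
    also have "\<dots> \<le> (col B l \<bullet> col B l) * ((col ?P i \<bullet> col ?P i) * principal_minor (gram ?P) T)"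
      using insert.IH[of ?P] insert.prems il by (intro mult_left_mono) auto
    also have "\<dots> \<le> (col B l \<bullet> col B l) * ((col B i \<bullet> col B i) * principal_minor (gram ?P) T)"
      using le insert.prems by (intro mult_left_mono mult_right_mono principal_minor_gram_nonneg) auto
    also have "\<dots> = (col B i \<bullet> col B i) * principal_minor (gram B) (insert l T)"
      using insert by (simp add: principal_minor_gram_insert)
    finally show ?case .
  qed
qed

text \<open>Double counting: a set \<open>S\<close> of size \<open>j + 1\<close> arises as
  \<open>insert i T\<close> once for each of its \<open>j + 1\<close> elements
  \<open>i\<close>.\<close>

lemma minor_sum_gram_proj_out_col:
  "(\<Sum>i<dim_col B. (col B i \<bullet> col B i) * minor_sum (gram (proj_out_col B i)) j)
     = real (j + 1) * minor_sum (gram B) (j + 1)"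
proof -
  let ?N = "{..<dim_col B}"
  let ?pm = "principal_minor (gram B)"
  have fin: "finite {T. T \<subseteq> ?N \<and> P T}" for P
    by (rule finite_subset[of _ "Pow ?N"]) auto
  have "(col B i \<bullet> col B i) * minor_sum (gram (proj_out_col B i)) j
      = (\<Sum>S | S \<subseteq> ?N \<and> card S = j + 1. if i \<in> S then ?pm S else 0)" if i: "i < dim_col B" for i
  proof -
    \<comment> \<open>Sets containing \<open>i\<close> drop out: either the projected column
      \<open>i\<close> is zero and the minor has a zero row, or column \<open>i\<close> was zero
      already and the weight is 0.\<close>
    have zero: "(col B i \<bullet> col B i) * principal_minor (gram (proj_out_col B i)) T = 0" if "i \<in> T" for T
    proof (cases "col B i \<bullet> col B i = 0")
      case False
      then have "principal_minor (gram (proj_out_col B i)) T = 0"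
        using i that by (intro principal_minor_zero_row[of i])
          (auto simp: gram_proj_out_col simp del: index_mult_mat(1), simp add: gram_index del: index_mult_mat(1))
      then show ?thesis by simp
    qed simp
    have "(col B i \<bullet> col B i) * minor_sum (gram (proj_out_col B i)) j
        = (\<Sum>T | T \<subseteq> ?N \<and> card T = j. (col B i \<bullet> col B i) * principal_minor (gram (proj_out_col B i)) T)"
      by (simp add: minor_sum_def sum_distrib_left)
    also have "\<dots> = (\<Sum>T | T \<subseteq> ?N \<and> card T = j \<and> i \<notin> T.
        (col B i \<bullet> col B i) * principal_minor (gram (proj_out_col B i)) T)"
      by (rule sum.mono_neutral_right[OF fin]) (use zero in auto)
    also have "\<dots> = (\<Sum>T | T \<subseteq> ?N \<and> card T = j \<and> i \<notin> T. ?pm (insert i T))"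
      using i by (intro sum.cong) (auto simp: principal_minor_gram_insert)
    also have "\<dots> = (\<Sum>S | S \<subseteq> ?N \<and> card S = j + 1 \<and> i \<in> S. ?pm S)"
    proof (rule sum.reindex_bij_witness[of _ "\<lambda>S. S - {i}" "insert i"])
      fix T assume "T \<in> {T. T \<subseteq> ?N \<and> card T = j \<and> i \<notin> T}"
      then show "insert i T \<in> {S. S \<subseteq> ?N \<and> card S = j + 1 \<and> i \<in> S}"
        using i finite_subset[of T ?N] by auto
    next
      fix S assume "S \<in> {S. S \<subseteq> ?N \<and> card S = j + 1 \<and> i \<in> S}"
      then show "S - {i} \<in> {T. T \<subseteq> ?N \<and> card T = j \<and> i \<notin> T}"
        using finite_subset[of S ?N] by auto
    qed auto
    also have "\<dots> = (\<Sum>S | S \<subseteq> ?N \<and> card S = j + 1. if i \<in> S then ?pm S else 0)"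
      by (rule sum.mono_neutral_cong_left[OF fin]) auto
    finally show ?thesis .
  qed
  then have "(\<Sum>i<dim_col B. (col B i \<bullet> col B i) * minor_sum (gram (proj_out_col B i)) j)
      = (\<Sum>i\<in>?N. \<Sum>S | S \<subseteq> ?N \<and> card S = j + 1. if i \<in> S then ?pm S else 0)"
    by (intro sum.cong) auto
  also have "\<dots> = (\<Sum>S | S \<subseteq> ?N \<and> card S = j + 1. \<Sum>i\<in>?N. if i \<in> S then ?pm S else 0)"
    by (rule sum.swap)
  also have "\<dots> = (\<Sum>S | S \<subseteq> ?N \<and> card S = j + 1. real (j + 1) * ?pm S)"
  proof (rule sum.cong, rule refl)
    fix S assume S: "S \<in> {S. S \<subseteq> ?N \<and> card S = j + 1}"
    then have "(\<Sum>i\<in>?N. if i \<in> S then ?pm S else 0) = (\<Sum>i\<in>S. ?pm S)"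
      by (intro sum.mono_neutral_cong_right) auto
    with S show "(\<Sum>i\<in>?N. if i \<in> S then ?pm S else 0) = real (j + 1) * ?pm S" by simp
  qed
  also have "\<dots> = real (j + 1) * minor_sum (gram B) (j + 1)"
    by (simp add: minor_sum_def sum_distrib_left)
  finally show ?thesis .
qed

section \<open>Rank and low-rank approximation\<close>

lemma (in vec_space) rank_le_card_if_span:
  assumes A: "A \<in> carrier_mat n nc" and W: "finite W" "W \<subseteq> carrier_vec n"
    and sub: "set (cols A) \<subseteq> span W"
  shows "rank A \<le> card W"
proof -
  obtain S where S: "maximal S (\<lambda>T. T \<subseteq> set (cols A) \<and> lin_indpt T)" "finite S"
    using maximal_exists_superset[of "set (cols A)" "\<lambda>T. T \<subseteq> set (cols A) \<and> lin_indpt T" "{}"]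
    by (auto simp: finite_lin_indpt2)
  then have "lin_indpt S" "S \<subseteq> span W" using sub unfolding maximal_def by auto
  then have "card S \<le> card W"
    using replacement[OF S(2) W(1)] W(2) by fastforce
  then show ?thesis using rank_card_indpt[OF A S(1)] by simp
qed

lemma (in vec_space) rank_spanning_columns:
  assumes A: "A \<in> carrier_mat n nc"
  obtains W where "W \<subseteq> set (cols A)" "card W = rank A" "set (cols A) \<subseteq> span W"
proof -
  have carr: "set (cols A) \<subseteq> carrier_vec n" using A cols_dim by blast
  obtain S where S: "maximal S (\<lambda>T. T \<subseteq> set (cols A) \<and> lin_indpt T)" "finite S"
    using maximal_exists_superset[of "set (cols A)" "\<lambda>T. T \<subseteq> set (cols A) \<and> lin_indpt T" "{}"]
    by (auto simp: finite_lin_indpt2)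
  have li: "lin_indpt S" and sub: "S \<subseteq> set (cols A)" using S(1) unfolding maximal_def by auto
  have "s \<in> span S" if s: "s \<in> set (cols A)" for s
  proof (rule ccontr)
    assume ns: "s \<notin> span S"
    then have "lin_indpt (S \<union> {s})"
      using lin_dep_iff_in_span[of S s] carr li sub s by (metis in_mono span_mem subset_trans)
    then have "S \<union> {s} = S" using S(1) s sub unfolding maximal_def by blast
    then show False using ns carr sub span_mem by (metis Un_insert_right insertI1 subset_trans)
  qed
  then show thesis using that[OF sub] rank_card_indpt[OF A S(1)] by auto
qed

text \<open>The columns of the removed part are multiples of \<open>col B i\<close>, so it has rank
  at most 1. Hence enough rank is left for the remaining iterations.\<close>

lemma rank_proj_out_col:
  "vec_space.rank (dim_row B) B \<le> vec_space.rank (dim_row B) (proj_out_col B i) + 1"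
proof -
  interpret vec_space "TYPE(real)" "dim_row B" .
  let ?p = "dim_row B" and ?q = "dim_col B"
  let ?D = "B - proj_out_col B i"
  have c: "B \<in> carrier_mat ?p ?q" "proj_out_col B i \<in> carrier_mat ?p ?q" "?D \<in> carrier_mat ?p ?q"
    by (auto intro!: carrier_matI)
  have "set (cols ?D) \<subseteq> span {col B i}"
  proof
    fix v assume "v \<in> set (cols ?D)"
    then obtain s where s: "s < ?q" "v = col ?D s" by (auto simp: cols_def)
    have "v = ((col B i \<bullet> col B s) / (col B i \<bullet> col B i)) \<cdot>\<^sub>v col B i"
      using s by (intro eq_vecI) (auto simp: proj_out_col_index)
    moreover have "col B i \<in> span {col B i}" by (rule span_mem) auto
    ultimately show "v \<in> span {col B i}" by (auto intro!: smult_in_span)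
  qed
  then have "rank ?D \<le> 1" using rank_le_card_if_span[OF c(3), of "{col B i}"] by simp
  moreover have "B = proj_out_col B i + ?D"
    by (rule eq_matI) auto
  ultimately show ?thesis using rank_subadditive[OF c(2,3)] by simp
qed

text \<open>Induction through \<open>minor_sum_gram_proj_out_col\<close>: positive rank provides a
  nonzero column, projecting it out costs at most one in the rank, and so its summand is positive by
  the induction hypothesis.\<close>

lemma minor_sum_gram_pos:
  "k \<le> vec_space.rank (dim_row B) B \<Longrightarrow> 0 < minor_sum (gram B) k"
proof (induction k arbitrary: B)
  case (Suc k)
  interpret vec_space "TYPE(real)" "dim_row B" .
  let ?N = "{..<dim_col B}"
  have "\<exists>i<dim_col B. col B i \<noteq> 0\<^sub>v (dim_row B)"
  proof (rule ccontr)
    assume "\<not> ?thesis"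
    then have "set (cols B) \<subseteq> {0\<^sub>v (dim_row B)}" by (auto simp: cols_def)
    then have "set (cols B) \<subseteq> span {}" by (auto simp: span_empty)
    then have "rank B \<le> 0" using rank_le_card_if_span[of B "dim_col B" "{}"] by auto
    with Suc.prems show False by simp
  qed
  then obtain i where i: "i < dim_col B" "col B i \<noteq> 0\<^sub>v (dim_row B)" by blast
  have "0 < col B i \<bullet> col B i"
    using i by (intro scalar_prod_self_pos[of _ "dim_row B"]) auto
  moreover have "k \<le> vec_space.rank (dim_row B) (proj_out_col B i)"
    using Suc.prems rank_proj_out_col[of B i] by simp
  then have "0 < minor_sum (gram (proj_out_col B i)) k" using Suc.IH[of "proj_out_col B i"] by simp
  ultimately have "0 < (\<Sum>i<dim_col B. (col B i \<bullet> col B i) * minor_sum (gram (proj_out_col B i)) k)"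
    using i by (intro sum_pos2[of _ i]) (auto intro!: mult_nonneg_nonneg minor_sum_gram_nonneg)
  then show ?case
    unfolding minor_sum_gram_proj_out_col by (simp add: zero_less_mult_iff)
qed simp

text \<open>Fewer than \<open>p\<close> vectors, padded with zero rows, form a singular square
  matrix; a normalized kernel vector is the witness.\<close>

lemma exists_unit_orthogonal:
  assumes "set ws \<subseteq> carrier_vec p" "length ws < p"
  obtains u :: "real vec" where "u \<in> carrier_vec p" "u \<bullet> u = 1" "\<And>w. w \<in> set ws \<Longrightarrow> w \<bullet> u = 0"
proof -
  define N where "N = mat p p (\<lambda>(i, j). if i < length ws then ws ! i $ j else 0)"
  have N: "N \<in> carrier_mat p p" by (simp add: N_def)
  have "mat p p (\<lambda>(i, j). if i \<in> {..<p} then N $$ (i, j) else if i = j then 1 else 0) = N"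
    using N by (intro eq_matI) auto
  then have "det N = principal_minor N {..<p}"
    using N by (simp add: principal_minor_def)
  also have "\<dots> = 0"
    by (rule principal_minor_zero_row[of "length ws"]) (use assms in \<open>auto simp: N_def\<close>)
  finally obtain v where v: "v \<in> carrier_vec p" "v \<noteq> 0\<^sub>v p" "N *\<^sub>v v = 0\<^sub>v p"
    using det_0_iff_vec_prod_zero[OF N] by blast
  then have pos: "0 < v \<bullet> v" by (intro scalar_prod_self_pos)
  have orth: "w \<bullet> v = 0" if "w \<in> set ws" for w
  proof -
    from that obtain i where i: "i < length ws" "w = ws ! i" by (metis in_set_conv_nth)
    then have "w \<in> carrier_vec p" using assms(1) that by blast
    then have "row N i = w" using i assms by (intro eq_vecI) (auto simp: N_def)
    then show ?thesis using arg_cong[OF v(3), of "\<lambda>x. x $ i"] i assms N by simp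
  qed
  define u where "u = (1 / sqrt (v \<bullet> v)) \<cdot>\<^sub>v v"
  show thesis
  proof
    show "u \<in> carrier_vec p" using v by (simp add: u_def)
    show "u \<bullet> u = 1" using v pos by (simp add: u_def)
    show "w \<bullet> u = 0" if "w \<in> set ws" for w
      using orth[OF that] that assms(1) v by (simp add: u_def scalar_prod_smult_distrib subset_iff)
  qed
qed

text \<open>The first \<open>p - length ws\<close> vectors are chosen orthogonal to
  \<open>ws\<close> as well as to their predecessors; the later ones only complete the orthonormal
  family.\<close>

lemma exists_orthonormal_list:
  fixes ws :: "real vec list"
  assumes ws: "set ws \<subseteq> carrier_vec p" and m: "m \<le> p"
  shows "\<exists>us. length us = m \<and> set us \<subseteq> carrier_vec p
    \<and> (\<forall>i<m. \<forall>j<m. us ! i \<bullet> us ! j = (if i = j then 1 else 0))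
    \<and> (\<forall>i<m. i + length ws < p \<longrightarrow> (\<forall>w\<in>set ws. w \<bullet> us ! i = 0))"
  using m
proof (induction m)
  case (Suc m)
  then obtain us where us: "length us = m" "set us \<subseteq> carrier_vec p"
    "\<And>i j. i < m \<Longrightarrow> j < m \<Longrightarrow> us ! i \<bullet> us ! j = (if i = j then 1 else 0)"
    "\<And>i w. i < m \<Longrightarrow> i + length ws < p \<Longrightarrow> w \<in> set ws \<Longrightarrow> w \<bullet> us ! i = 0"
    by (auto dest: Suc_leD)
  \<comment> \<open>Once \<open>m + length ws\<close> reaches \<open>p\<close>, the vectors
    \<open>ws\<close> are dropped, so there are always fewer than \<open>p\<close>
    constraints.\<close>
  obtain u where u: "u \<in> carrier_vec p" "u \<bullet> u = 1"
    "\<And>w. w \<in> set (us @ (if m + length ws < p then ws else [])) \<Longrightarrow> w \<bullet> u = 0"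
  proof (rule exists_unit_orthogonal)
    show "set (us @ (if m + length ws < p then ws else [])) \<subseteq> carrier_vec p"
      using us ws by auto
    show "length (us @ (if m + length ws < p then ws else [])) < p"
      using us Suc.prems by auto
  qed blast
  have in_p: "us ! i \<in> carrier_vec p" if "i < m" for i using us that by auto
  have orth: "us ! i \<bullet> u = 0" "u \<bullet> us ! i = 0" if "i < m" for i
    using u(3)[of "us ! i"] us(1) that comm_scalar_prod[OF u(1) in_p[OF that]] by auto
  show ?case
    by (rule exI[of _ "us @ [u]"])
      (use us u orth in \<open>auto simp: nth_append less_Suc_eq\<close>)
qed simp

section \<open>Consecutive minor sums and the distance to low-rank matrices\<close>

lemma minor_sum_1: "minor_sum H 1 = (\<Sum>i<dim_row H. H $$ (i, i))"
proof -
  have "minor_sum H 1 = sum (principal_minor H) ((\<lambda>i. {i}) ` {..<dim_row H})"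
    unfolding minor_sum_def by (rule sum.cong) (auto simp: card_1_singleton_iff)
  also have "\<dots> = (\<Sum>i<dim_row H. H $$ (i, i))"
    by (subst sum.reindex) (auto simp: principal_minor_singleton)
  finally show ?thesis .
qed

text \<open>A set of \<open>Suc k\<close> indices does not fit into the last \<open>k\<close>
  columns, so it contains one of the first \<open>dim_col N - k\<close>. Fischer's inequality splits
  that column off; then the two sums are exchanged and the condition \<open>i \<notin> T\<close> is
  relaxed.\<close>

lemma minor_sum_gram_Suc_le:
  "minor_sum (gram N) (Suc k)
     \<le> minor_sum (gram N) k * (\<Sum>i<dim_col N - k. col N i \<bullet> col N i)"
proof -
  let ?N = "{..<dim_col N}" and ?pm = "principal_minor (gram N)"
  let ?I = "{..<dim_col N - k}" and ?S = "{T. T \<subseteq> {..<dim_col N} \<and> card T = Suc k}"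
  have fin: "finite {T. T \<subseteq> ?N \<and> P T}" for P
    by (rule finite_subset[of _ "Pow ?N"]) auto
  have "?pm T \<le> (\<Sum>i\<in>?I. if i \<in> T then (col N i \<bullet> col N i) * ?pm (T - {i}) else 0)"
    if T: "T \<in> ?S" for T
  proof -
    have "\<not> T \<subseteq> {dim_col N - k..<dim_col N}"
      using T card_mono[of "{dim_col N - k..<dim_col N}" T] by auto
    then obtain i where i: "i \<in> T" "i \<in> ?I" using T by (auto simp: subset_iff not_le)
    have "?pm T \<le> (col N i \<bullet> col N i) * ?pm (T - {i})"
      using principal_minor_gram_insert_le[of i N "T - {i}"] i T by (auto simp: insert_absorb)
    also have "\<dots> \<le> (\<Sum>i\<in>?I. if i \<in> T then (col N i \<bullet> col N i) * ?pm (T - {i}) else 0)"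
      using i T by (intro member_le_sum[of i, THEN order_trans[rotated]])
        (auto intro!: mult_nonneg_nonneg principal_minor_gram_nonneg)
    finally show ?thesis .
  qed
  then have "minor_sum (gram N) (Suc k)
      \<le> (\<Sum>T\<in>?S. \<Sum>i\<in>?I. if i \<in> T then (col N i \<bullet> col N i) * ?pm (T - {i}) else 0)"
    unfolding minor_sum_def dim_col index_mult_mat index_transpose_mat by (rule sum_mono)
  also have "\<dots> = (\<Sum>i\<in>?I. \<Sum>T\<in>?S. if i \<in> T then (col N i \<bullet> col N i) * ?pm (T - {i}) else 0)"
    by (rule sum.swap)
  also have "\<dots> \<le> (\<Sum>i\<in>?I. (col N i \<bullet> col N i) * minor_sum (gram N) k)"
  proof (rule sum_mono)
    fix i assume i: "i \<in> ?I"
    have "(\<Sum>T\<in>?S. if i \<in> T then (col N i \<bullet> col N i) * ?pm (T - {i}) else 0)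
        = (\<Sum>T | T \<subseteq> ?N \<and> card T = Suc k \<and> i \<in> T. (col N i \<bullet> col N i) * ?pm (T - {i}))"
      by (rule sum.mono_neutral_cong_right[OF fin]) auto
    also have "\<dots> = (\<Sum>T | T \<subseteq> ?N \<and> card T = k \<and> i \<notin> T. (col N i \<bullet> col N i) * ?pm T)"
    proof (rule sum.reindex_bij_witness[of _ "insert i" "\<lambda>T. T - {i}"])
      fix T assume "T \<in> {T. T \<subseteq> ?N \<and> card T = k \<and> i \<notin> T}"
      then show "insert i T \<in> {T. T \<subseteq> ?N \<and> card T = Suc k \<and> i \<in> T}"
        using i finite_subset[of T ?N] by auto
    next
      fix T assume "T \<in> {T. T \<subseteq> ?N \<and> card T = Suc k \<and> i \<in> T}"
      then show "T - {i} \<in> {T. T \<subseteq> ?N \<and> card T = k \<and> i \<notin> T}"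
        using finite_subset[of T ?N] by auto
    qed auto
    also have "\<dots> \<le> (\<Sum>T | T \<subseteq> ?N \<and> card T = k. (col N i \<bullet> col N i) * ?pm T)"
      by (rule sum_mono2[OF fin]) (auto intro!: mult_nonneg_nonneg principal_minor_gram_nonneg)
    finally show "(\<Sum>T\<in>?S. if i \<in> T then (col N i \<bullet> col N i) * ?pm (T - {i}) else 0)
        \<le> (col N i \<bullet> col N i) * minor_sum (gram N) k"
      by (simp add: minor_sum_def sum_distrib_left)
  qed
  finally show ?thesis unfolding sum_distrib_left by (simp only: mult.commute)
qed

text \<open>Stands in for \<open>e_(k+1) \<le> e_k * (\<lambda>_(k+1) + \<dots> + \<lambda>_p)\<close> combined with Eckart--Young. No eigenvalues are
  needed: rotate the rows so that the first \<open>p - k\<close> coordinates are orthogonal to the columns of \<open>X\<close>;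
  each index set of size \<open>k + 1\<close> contains one of them, which Fischer's inequality splits off.\<close>

lemma minor_sum_gram_ratio_le:
  fixes M X :: "real mat"
  assumes M: "M \<in> carrier_mat p q" and X: "X \<in> carrier_mat p q"
    and rank: "vec_space.rank p X \<le> k"
  shows "minor_sum (gram M) (Suc k) \<le> minor_sum (gram M) k * minor_sum (gram (M - X)) 1"
proof -
  interpret vec_space "TYPE(real)" p .
  obtain W where W: "W \<subseteq> set (cols X)" "card W = rank X" "set (cols X) \<subseteq> span W"
    using rank_spanning_columns[OF X] .
  have Wp: "W \<subseteq> carrier_vec p" using W(1) X cols_dim by blast
  obtain ws where ws: "set ws = W" "length ws = card W"
    using W(1) by (metis List.finite_set finite_subset finite_distinct_list distinct_card)
  obtain us where us: "length us = p" "set us \<subseteq> carrier_vec p"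
    "\<And>i j. i < p \<Longrightarrow> j < p \<Longrightarrow> us ! i \<bullet> us ! j = (if i = j then 1 else 0)"
    "\<And>i w. i < p \<Longrightarrow> i + length ws < p \<Longrightarrow> w \<in> W \<Longrightarrow> w \<bullet> us ! i = 0"
    using exists_orthonormal_list[of ws p p] Wp ws by auto
  define U where "U = mat_of_rows p us"
  have U: "U \<in> carrier_mat p p" by (simp add: U_def us(1)[symmetric])
  have us_p: "us ! i \<in> carrier_vec p" if "i < p" for i using us that by auto
  have rowU: "row U i = us ! i" if "i < p" for i using us_p us(1) that by (simp add: U_def)
  have "U * transpose_mat U = 1\<^sub>m p"
    using U us(3) by (intro eq_matI) (auto simp: rowU)
  then have UU: "transpose_mat U * U = 1\<^sub>m p"
    using U by (intro mat_mult_left_right_inverse[of U p]) auto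
  \<comment> \<open>Passing to the rotated transpose makes the new coordinates into columns.
    \<open>U\<close> cancels in the product with the transpose, and
    \<open>minor_sum_mult_transpose\<close> moves between the two Gram matrices.\<close>
  have inv: "minor_sum (gram (transpose_mat A * transpose_mat U)) j = minor_sum (gram A) j"
    if A: "A \<in> carrier_mat p q" for A j
  proof -
    let ?N = "transpose_mat A * transpose_mat U"
    have "minor_sum (gram ?N) j = minor_sum (?N * transpose_mat ?N) j"
      by (rule minor_sum_mult_transpose[symmetric, of _ q p]) (use A U in auto)
    also have "?N * transpose_mat ?N = ?N * (U * A)"
      using A U by (simp add: transpose_mult[of _ q p _ p])
    also have "\<dots> = transpose_mat A * (transpose_mat U * U * A)"
      using A U by (simp add: assoc_mult_mat[of _ q p _ p _ q] assoc_mult_mat[of _ p p _ p _ q])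
    also have "\<dots> = gram A" using A by (simp add: UU)
    finally show ?thesis .
  qed
  have colN: "col (transpose_mat A * transpose_mat U) i = transpose_mat A *\<^sub>v us ! i"
    if "A \<in> carrier_mat p q" "i < p" for A i
    using that U rowU[of i] by (intro eq_vecI) auto
  \<comment> \<open>\<open>W\<close> has at most \<open>k\<close> members, so for
    \<open>i < p - k\<close> the vector \<open>us ! i\<close> is orthogonal to all of them, and
    hence to the columns of \<open>X\<close>, which lie in \<open>span W\<close>.\<close>
  have colX: "transpose_mat X *\<^sub>v us ! i = 0\<^sub>v q" if i: "i < p - k" for i
  proof (rule eq_vecI)
    fix j assume "j < dim_vec (0\<^sub>v q :: real vec)"
    then have j: "j < q" by simp
    have "col X j \<in> span W" using W(3) X j by (auto simp: cols_def)
    moreover have "us ! i \<bullet> w = 0" if "w \<in> W" for w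
      using us(4)[of i w] us_p[of i] i rank ws(2) W(2) Wp that comm_scalar_prod[of "us ! i" p w] by auto
    then have "us ! i \<in> orthogonal_complement W"
      using us_p[of i] i by (simp add: orthogonal_complement_def)
    then have "us ! i \<in> orthogonal_complement (span W)"
      using in_orthogonal_complement_span[OF Wp] by blast
    ultimately have "us ! i \<bullet> col X j = 0" by (simp add: orthogonal_complement_def)
    then have "col X j \<bullet> us ! i = 0"
      using us_p[of i] i X comm_scalar_prod[of "us ! i" p "col X j"] col_dim[of X j] by simp
    then show "(transpose_mat X *\<^sub>v us ! i) $ j = 0\<^sub>v q $ j" using X j by simp
  qed (use X in simp)
  let ?N = "transpose_mat M * transpose_mat U"
  let ?E = "transpose_mat (M - X) * transpose_mat U"
  have dimc: "dim_col ?N = p" "dim_col ?E = p" using U by auto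
  have eq: "col ?N i = col ?E i" if i: "i < p - k" for i
  proof -
    have "transpose_mat (M - X) *\<^sub>v us ! i = transpose_mat M *\<^sub>v us ! i - transpose_mat X *\<^sub>v us ! i"
      using M X us_p[of i] i
      by (simp add: transpose_minus[of _ p q] minus_mult_distrib_mat_vec[of _ q p])
    also have "\<dots> = transpose_mat M *\<^sub>v us ! i"
      using colX[OF i] M by (intro eq_vecI) auto
    finally show ?thesis using colN[OF M, of i] colN[OF minus_carrier_mat[OF X], of i M] i by simp
  qed
  have "(\<Sum>i<p - k. col ?N i \<bullet> col ?N i) = (\<Sum>i<p - k. col ?E i \<bullet> col ?E i)"
    by (rule sum.cong) (simp_all only: eq lessThan_iff)
  also have "\<dots> \<le> (\<Sum>i<p. col ?E i \<bullet> col ?E i)"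
    by (rule sum_mono2) auto
  also have "\<dots> = minor_sum (gram ?E) 1"
    unfolding minor_sum_1 using U by (intro sum.cong) auto
  also have "\<dots> = minor_sum (gram (M - X)) 1" using M X by (intro inv) auto
  finally have "(\<Sum>i<p - k. col ?N i \<bullet> col ?N i) \<le> minor_sum (gram (M - X)) 1" .
  then have "minor_sum (gram ?N) k * (\<Sum>i<p - k. col ?N i \<bullet> col ?N i)
      \<le> minor_sum (gram ?N) k * minor_sum (gram (M - X)) 1"
    by (intro mult_left_mono minor_sum_gram_nonneg)
  then show ?thesis
    using minor_sum_gram_Suc_le[of ?N k] unfolding inv[OF M] dimc by simp
qed

section \<open>Column subset selection\<close>

lemma cols_sub_carrier [simp]: "cols_sub M S \<in> carrier_mat (dim_row M) (length S)"
  and dim_row_cols_sub [simp]: "dim_row (cols_sub M S) = dim_row M"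
  and dim_col_cols_sub [simp]: "dim_col (cols_sub M S) = length S"
  using mat_of_cols_carrier[of "dim_row M" "map (col M) S"] by (simp_all add: cols_sub_def)

lemma cols_sub_index [simp]:
  "r < dim_row M \<Longrightarrow> a < length S \<Longrightarrow> cols_sub M S $$ (r, a) = M $$ (r, S ! a)"
  by (simp add: cols_sub_def mat_of_cols_index col_def)

lemma col_cols_sub [simp]: "a < length S \<Longrightarrow> col (cols_sub M S) a = col M (S ! a)"
  by (rule eq_vecI) (auto simp: col_def)

section \<open>Pseudoinverses of the chosen columns\<close>

lemma pinv_eqI: "is_pinv M X \<Longrightarrow> pinv M = X"
  unfolding pinv_def using is_pinv_unique by blast

text \<open>\<open>pinv\<close> is a definite description, so existence requires an explicit
  candidate. For a left inverse, the symmetry of \<open>N * Y\<close> is the only Penrose condition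
  that is not automatic.\<close>

lemma is_pinv_left_inverse:
  assumes N: "N \<in> carrier_mat p t" and Y: "Y \<in> carrier_mat t p"
    and "Y * N = 1\<^sub>m t" "transpose_mat (N * Y) = N * Y"
  shows "is_pinv N Y"
  using assms assoc_mult_mat[OF N Y N] assoc_mult_mat[OF Y N Y] by (simp add: is_pinv_def)

lemma residual_orthogonal:
  fixes M P :: "real mat"
  assumes M: "M \<in> carrier_mat p q" and P: "P \<in> carrier_mat p p" and sym: "transpose_mat P = P"
    and Z: "Z \<in> carrier_mat p m" and PZ: "P * Z = Z"
  shows "transpose_mat (M - P * M) * Z = 0\<^sub>m q m"
proof -
  have MT: "transpose_mat M \<in> carrier_mat q p" using M by simp
  have "transpose_mat (M - P * M) = transpose_mat M - transpose_mat M * P"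
    using M P sym by (simp add: transpose_minus[of _ p q] transpose_mult[of _ p p _ q])
  then have "transpose_mat (M - P * M) * Z = transpose_mat M * Z - transpose_mat M * P * Z"
    using MT P Z by (simp add: minus_mult_distrib_mat[of _ q p])
  also have "transpose_mat M * P * Z = transpose_mat M * Z"
    using assoc_mult_mat[OF MT P Z] PZ by simp
  finally show ?thesis using MT Z by auto
qed

text \<open>One Gram-Schmidt step. The residual of the new column is orthogonal to the span of the
  old ones, so the projection grows by a rank-one term and the new residual is \<open>B\<close> with
  its column \<open>i\<close> projected out.\<close>

lemma left_inverse_append_col:
  assumes M: "M \<in> carrier_mat p q" and Y: "Y \<in> carrier_mat (length S) p"
    and YN: "Y * cols_sub M S = 1\<^sub>m (length S)"
    and sym: "transpose_mat (cols_sub M S * Y) = cols_sub M S * Y"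
    and B: "B = M - cols_sub M S * Y * M"
    and i: "i < q" "col B i \<noteq> 0\<^sub>v p"
  shows "\<exists>Y'\<in>carrier_mat (Suc (length S)) p.
    Y' * cols_sub M (S @ [i]) = 1\<^sub>m (Suc (length S)) \<and>
    transpose_mat (cols_sub M (S @ [i]) * Y') = cols_sub M (S @ [i]) * Y' \<and>
    M - cols_sub M (S @ [i]) * Y' * M = proj_out_col B i"
proof -
  define N where "N = cols_sub M S"
  define t where "t = length S"
  define b where "b = col B i"
  define m where "m = col M i"
  define N' where "N' = cols_sub M (S @ [i])"
  define P where "P = N * Y"
  \<comment> \<open>The new column satisfies \<open>m = b + P *\<^sub>v m\<close>. Its coefficient
    is read off by \<open>b\<close> divided by \<open>b \<bullet> b\<close>; the earlier rows
    subtract that coefficient times \<open>Y *\<^sub>v m\<close>, which is what \<open>m\<close>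
    already contributes within the old span.\<close>
  define Y' where "Y' = mat (Suc t) p (\<lambda>(a, c).
    if a < t then Y $$ (a, c) - (row Y a \<bullet> m) / (b \<bullet> b) * b $ c else b $ c / (b \<bullet> b))"
  have N: "N \<in> carrier_mat p t" using M cols_sub_carrier[of M S] by (simp add: N_def t_def)
  have Y: "Y \<in> carrier_mat t p" using Y by (simp add: t_def)
  have P: "P \<in> carrier_mat p p" using N Y by (simp add: P_def)
  have BP: "B = M - P * M" using B by (simp add: N_def P_def)
  have Bc: "B \<in> carrier_mat p q" using BP M P by auto
  have symP: "transpose_mat P = P" using sym by (simp add: P_def N_def)
  have PN: "P * N = N" using assoc_mult_mat[OF N Y N] YN N by (simp add: P_def N_def t_def)
  have PP: "P * P = P" using assoc_mult_mat[OF P N Y] PN by (simp add: P_def)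
  have PPM: "P * (P * M) = P * M" using assoc_mult_mat[OF P P M] PP by simp
  have b: "b \<in> carrier_vec p" using Bc by (auto simp: b_def)
  have bb: "0 < b \<bullet> b" using i by (intro scalar_prod_self_pos[OF b]) (simp add: b_def)
  have bN: "b \<bullet> col N a = 0" if "a < t" for a
    using arg_cong[OF residual_orthogonal[OF M P symP N PN], of "\<lambda>A. A $$ (i, a)"] that i N Bc
    by (simp add: b_def BP[symmetric])
  have bPM: "b \<bullet> col (P * M) s = 0" if "s < q" for s
    using arg_cong[OF residual_orthogonal[OF M P symP mult_carrier_mat[OF P M] PPM],
        of "\<lambda>A. A $$ (i, s)"] that i M P Bc
    by (simp add: b_def BP[symmetric] del: col_mult2)
  \<comment> \<open>\<open>b\<close> is orthogonal to the columns of \<open>P * M\<close>, so it has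
    the same products with the columns of \<open>M\<close> and of \<open>B\<close>. For column
    \<open>i\<close> this gives \<open>b \<bullet> m = b \<bullet> b\<close>.\<close>
  have bM: "b \<bullet> col M s = b \<bullet> col B s" if s: "s < q" for s
  proof -
    have "col B s = col M s - col (P * M) s"
      using s M P by (intro eq_vecI) (auto simp: BP)
    then have "b \<bullet> col B s = b \<bullet> col M s - b \<bullet> col (P * M) s"
      using col_dim[of M s] col_dim[of "P * M" s] M P scalar_prod_minus_distrib[OF b] by simp
    with bPM[OF s] show ?thesis by simp
  qed
  then have bm: "b \<bullet> m = b \<bullet> b" using i by (simp add: m_def b_def)
  have rowY': "row Y' a = (if a < t then row Y a - ((row Y a \<bullet> m) / (b \<bullet> b)) \<cdot>\<^sub>v b
      else (1 / (b \<bullet> b)) \<cdot>\<^sub>v b)" if "a < Suc t" for a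
    using that Y b by (intro eq_vecI) (auto simp: Y'_def)
  have colN': "col N' c = (if c < t then col N c else m)" if "c < Suc t" for c
    using that by (auto simp: N'_def N_def m_def t_def nth_append)
  have N': "N' \<in> carrier_mat p (Suc t)"
    using M cols_sub_carrier[of M "S @ [i]"] by (simp add: N'_def t_def)
  have Y'c: "Y' \<in> carrier_mat (Suc t) p" by (simp add: Y'_def)
  have mp: "m \<in> carrier_vec p" using M by (auto simp: m_def)
  have "Y' * N' = 1\<^sub>m (Suc t)"
  proof (rule eq_matI)
    fix a c assume "a < dim_row (1\<^sub>m (Suc t) :: real mat)" "c < dim_col (1\<^sub>m (Suc t) :: real mat)"
    then have ac: "a < Suc t" "c < Suc t" by auto
    have YNac: "row Y a \<bullet> col N c = (if a = c then 1 else 0)" if "a < t" "c < t"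
      using arg_cong[OF YN, of "\<lambda>A. A $$ (a, c)"] that Y N by (simp add: N_def t_def)
    have Ya: "row Y a \<in> carrier_vec p" using Y by auto
    have Nc: "col N c \<in> carrier_vec p" using N by auto
    have "(Y' * N') $$ (a, c) = row Y' a \<bullet> col N' c" using ac Y'c N' by simp
    also have "\<dots> = (if a = c then 1 else 0)"
      using ac YNac bN[of c] bm bb b mp Ya Nc rowY'[OF ac(1)] colN'[OF ac(2)]
      by (auto simp: minus_scalar_prod_distrib[of _ p] less_Suc_eq split: if_splits)
    finally show "(Y' * N') $$ (a, c) = 1\<^sub>m (Suc t) $$ (a, c)" using ac by simp
  qed (use Y'c N' in auto)
  moreover have NY': "(N' * Y') $$ (r, s) = P $$ (r, s) + b $ r * b $ s / (b \<bullet> b)"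
    if rs: "r < p" "s < p" for r s
  proof -
    \<comment> \<open>The coefficients \<open>Y *\<^sub>v m\<close> reassemble
      \<open>P *\<^sub>v m\<close>, that is \<open>m - b\<close>; below, the terms with
      \<open>m\<close> cancel and only the rank-one term survives.\<close>
    have "(\<Sum>a = 0..<t. N $$ (r, a) * (row Y a \<bullet> m)) = (P *\<^sub>v m) $ r"
      using rs N Y mp by (simp add: P_def assoc_mult_mat_vec[OF N Y mp] scalar_prod_def)
    also have "\<dots> = (P * M) $$ (r, i)" using rs P M i by (simp add: m_def)
    also have "\<dots> = m $ r - b $ r" using rs M P i by (simp add: m_def b_def BP)
    finally have *: "(\<Sum>a = 0..<t. N $$ (r, a) * (row Y a \<bullet> m)) = m $ r - b $ r" .
    have "(N' * Y') $$ (r, s) = (\<Sum>a = 0..<Suc t. N' $$ (r, a) * Y' $$ (a, s))"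
      using rs N' Y'c by (simp add: scalar_prod_def)
    also have "\<dots> = (\<Sum>a = 0..<t. N $$ (r, a) * Y $$ (a, s)
        - b $ s / (b \<bullet> b) * (N $$ (r, a) * (row Y a \<bullet> m))) + m $ r * (b $ s / (b \<bullet> b))"
    proof -
      have "N' $$ (r, a) = (if a < t then N $$ (r, a) else m $ r)" if "a < Suc t" for a
        using that rs M by (auto simp: N'_def N_def m_def t_def nth_append col_def)
      then show ?thesis using rs
        by (auto simp: Y'_def algebra_simps intro!: sum.cong)
    qed
    also have "\<dots> = P $$ (r, s) - b $ s / (b \<bullet> b) * (m $ r - b $ r) + m $ r * (b $ s / (b \<bullet> b))"
      unfolding sum_subtractf sum_distrib_left[symmetric] *
      using rs N Y by (simp add: P_def scalar_prod_def)
    also have "\<dots> = P $$ (r, s) + b $ r * b $ s / (b \<bullet> b)"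
      by (simp add: algebra_simps diff_divide_distrib)
    finally show ?thesis .
  qed
  moreover have "transpose_mat (N' * Y') = N' * Y'"
  proof (rule eq_matI)
    fix r s assume "r < dim_row (N' * Y')" "s < dim_col (N' * Y')"
    then have rs: "r < p" "s < p" using N' Y'c by auto
    have "P $$ (s, r) = P $$ (r, s)"
      using arg_cong[OF symP, of "\<lambda>A. A $$ (r, s)"] rs P by simp
    then show "transpose_mat (N' * Y') $$ (r, s) = (N' * Y') $$ (r, s)"
      using NY'[OF rs] NY'[OF rs(2,1)] rs N' Y'c by (simp add: mult.commute del: index_mult_mat(1))
  qed (use N' Y'c in auto)
  moreover have "M - N' * Y' * M = proj_out_col B i"
  proof -
    define Q where "Q = N' * Y'"
    have Q: "Q \<in> carrier_mat p p" using N' Y'c by (simp add: Q_def)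
    have "M - Q * M = proj_out_col B i"
    proof (rule eq_matI)
      fix r s assume "r < dim_row (proj_out_col B i)" "s < dim_col (proj_out_col B i)"
      then have rs: "r < p" "s < q" using Bc by auto
      have "(Q * M) $$ (r, s) = (\<Sum>a = 0..<p. Q $$ (r, a) * M $$ (a, s))"
        using rs Q M by (simp add: scalar_prod_def)
      also have "\<dots> = (\<Sum>a = 0..<p. P $$ (r, a) * M $$ (a, s) + b $ r / (b \<bullet> b) * (b $ a * M $$ (a, s)))"
        using rs NY' by (intro sum.cong) (auto simp: Q_def algebra_simps)
      also have "\<dots> = (P * M) $$ (r, s) + b $ r / (b \<bullet> b) * (b \<bullet> col M s)"
        using rs P M b unfolding sum.distrib sum_distrib_left[symmetric] by (simp add: scalar_prod_def)
      finally have "(M - Q * M) $$ (r, s) = B $$ (r, s) - b $ r / (b \<bullet> b) * (b \<bullet> col B s)"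
        using rs Q M P bM[OF rs(2)] by (simp add: BP del: index_mult_mat(1))
      then show "(M - Q * M) $$ (r, s) = proj_out_col B i $$ (r, s)"
        using rs Bc by (simp add: proj_out_col_index b_def[symmetric])
    qed (use Q M Bc in auto)
    then show ?thesis by (simp only: Q_def)
  qed
  ultimately show ?thesis using Y'c unfolding N'_def t_def by blast
qed

text \<open>In iteration \<open>s + 1\<close> the coefficient indices are \<open>p - (k - s)\<close>
  and \<open>p - (k - s - 1)\<close>, which belong to minors of order \<open>k - s\<close> and
  \<open>k - s - 1\<close>. The bounds \<open>k \<le> p\<close> and \<open>s < k\<close> make the
  natural subtractions exact.\<close>

lemma css_ratio_eq:
  assumes B: "B \<in> carrier_mat p q" and "k \<le> p" "s < k"
  shows "css_ratio B k (s + 1) i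
    = minor_sum (gram (proj_out_col B i)) (k - s) / minor_sum (gram (proj_out_col B i)) (k - s - 1)"
proof -
  let ?P = "proj_out_col B i"
  have P: "?P \<in> carrier_mat p q" using B by (auto intro!: carrier_matI)
  then have G: "?P * transpose_mat ?P \<in> carrier_mat p p" by simp
  have "p - k + (s + 1) - 1 = p - (k - s)" "p - k + (s + 1) = p - (k - s - 1)"
    using assms by auto
  then show ?thesis
    using assms det_coeff_eq_minor_sum[OF G, of "k - s"] det_coeff_eq_minor_sum[OF G, of "k - s - 1"]
    by (simp add: css_ratio_def Let_def minor_sum_mult_transpose[OF P])
qed

text \<open>The minimal ratio is at most the average of the ratios weighted by
  \<open>\<parallel>b\<^sub>i\<parallel>\<^sup>2 * minor_sum (gram (proj_out_col B i)) (k - s - 1)\<close>. The rank hypothesis keeps all denominators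
  positive, so that the convention \<open>x / 0 = 0\<close> cannot produce a spurious minimum.\<close>

lemma css_ratio_min_le:
  assumes B: "B \<in> carrier_mat p q" and "k \<le> p" "s < k"
    and rank: "k - s \<le> vec_space.rank p B"
    and i: "is_arg_min (css_ratio B k (s + 1)) (\<lambda>i. i < q \<and> col B i \<noteq> 0\<^sub>v p) i"
  shows "real (k - s) * minor_sum (gram B) (k - s) * minor_sum (gram (proj_out_col B i)) (k - s)
    \<le> real (k - s + 1) * minor_sum (gram B) (k - s + 1) * minor_sum (gram (proj_out_col B i)) (k - s - 1)"
proof -
  define d where "d = k - s - 1"
  define P where "P = proj_out_col B"
  have d: "k - s = Suc d" using assms(3) by (simp add: d_def)
  have pos: "0 < minor_sum (gram (P l)) d" for l
    using minor_sum_gram_pos[of d "P l"] rank_proj_out_col[of B l] rank B d by (simp add: P_def)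
  define r where "r = minor_sum (gram (P i)) (Suc d) / minor_sum (gram (P i)) d"
  \<comment> \<open>Clearing the denominator gives an inequality for every column: zero columns do
    not compete for the minimum, but contribute 0 to both sides.\<close>
  have le: "r * ((col B l \<bullet> col B l) * minor_sum (gram (P l)) d)
      \<le> (col B l \<bullet> col B l) * minor_sum (gram (P l)) (Suc d)" if l: "l < q" for l
  proof (cases "col B l = 0\<^sub>v p")
    case False
    then have "css_ratio B k (s + 1) i \<le> css_ratio B k (s + 1) l"
      using i l unfolding is_arg_min_def by (meson not_less)
    then have "r \<le> minor_sum (gram (P l)) (Suc d) / minor_sum (gram (P l)) d"
      using css_ratio_eq[OF assms(1-3)] d by (simp add: r_def P_def)
    then have "r * minor_sum (gram (P l)) d \<le> minor_sum (gram (P l)) (Suc d)"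
      using pos[of l] by (simp add: pos_le_divide_eq)
    then show ?thesis
      using mult_left_mono[OF _ scalar_prod_self_nonneg[of "col B l"]] by (simp only: mult.left_commute[of r])
  qed simp
  have "r * (real (Suc d) * minor_sum (gram B) (Suc d))
      = (\<Sum>l<q. r * ((col B l \<bullet> col B l) * minor_sum (gram (P l)) d))"
    using minor_sum_gram_proj_out_col[of B d] B by (simp add: sum_distrib_left[symmetric] P_def)
  also have "\<dots> \<le> (\<Sum>l<q. (col B l \<bullet> col B l) * minor_sum (gram (P l)) (Suc d))"
    by (rule sum_mono) (use le in auto)
  also have "\<dots> = real (Suc (Suc d)) * minor_sum (gram B) (Suc (Suc d))"
    using minor_sum_gram_proj_out_col[of B "Suc d"] B by (simp add: P_def)
  finally have "r * minor_sum (gram (P i)) d * (real (Suc d) * minor_sum (gram B) (Suc d))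
      \<le> minor_sum (gram (P i)) d * (real (Suc (Suc d)) * minor_sum (gram B) (Suc (Suc d)))"
    using pos[of i] by (simp add: mult_left_mono mult_ac)
  moreover have "r * minor_sum (gram (P i)) d = minor_sum (gram (P i)) (Suc d)"
    using pos[of i] by (simp add: r_def)
  ultimately have "minor_sum (gram (P i)) (Suc d) * (real (Suc d) * minor_sum (gram B) (Suc d))
      \<le> minor_sum (gram (P i)) d * (real (Suc (Suc d)) * minor_sum (gram B) (Suc (Suc d)))"
    by (simp only:)
  then show ?thesis unfolding d by (simp add: P_def mult_ac)
qed

text \<open>Loop invariant: each selected residual column is nonzero, so the selected columns of
  \<open>M\<close> stay independent and keep a left inverse, built up one column at a time.\<close>

lemma css_state_left_inverse:
  assumes "css_state M k S B" and M: "M \<in> carrier_mat p q"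
  shows "\<exists>Y\<in>carrier_mat (length S) p. Y * cols_sub M S = 1\<^sub>m (length S) \<and>
    transpose_mat (cols_sub M S * Y) = cols_sub M S * Y \<and> B = M - cols_sub M S * Y * M"
  using assms(1)
proof induction
  case init
  have e: "cols_sub M [] * 0\<^sub>m 0 p = 0\<^sub>m p p"
    using M by (intro eq_matI) (auto simp: scalar_prod_def)
  have "0\<^sub>m 0 p * cols_sub M [] = 1\<^sub>m 0" by (rule eq_matI) auto
  moreover have "M = M - 0\<^sub>m p p * M" using M by (intro eq_matI) auto
  ultimately show ?case
    by (intro bexI[of _ "0\<^sub>m 0 p"]) (simp_all add: e)
next
  case (step S B i)
  then obtain Y where Y: "Y \<in> carrier_mat (length S) p" "Y * cols_sub M S = 1\<^sub>m (length S)"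
    "transpose_mat (cols_sub M S * Y) = cols_sub M S * Y" "B = M - cols_sub M S * Y * M"
    by auto
  have i: "i < q" "col B i \<noteq> 0\<^sub>v p" using step.hyps(3) M by (auto simp: is_arg_min_def)
  from left_inverse_append_col[OF M Y i] obtain Y' where Y': "Y' \<in> carrier_mat (Suc (length S)) p"
    "Y' * cols_sub M (S @ [i]) = 1\<^sub>m (Suc (length S))"
    "transpose_mat (cols_sub M (S @ [i]) * Y') = cols_sub M (S @ [i]) * Y'" by blast
  have "pinv (cols_sub M (S @ [i])) = Y'"
    using M Y' cols_sub_carrier[of M "S @ [i]"] by (intro pinv_eqI is_pinv_left_inverse) auto
  with Y' show ?case by (intro bexI[of _ Y']) simp_all
qed

lemma css_state_pinv:
  assumes "css_state M k S B" and M: "M \<in> carrier_mat p q"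
  shows "is_pinv (cols_sub M S) (pinv (cols_sub M S))"
    and "B = M - cols_sub M S * pinv (cols_sub M S) * M"
proof -
  obtain Y where Y: "Y \<in> carrier_mat (length S) p" "Y * cols_sub M S = 1\<^sub>m (length S)"
    "transpose_mat (cols_sub M S * Y) = cols_sub M S * Y" "B = M - cols_sub M S * Y * M"
    using css_state_left_inverse[OF assms] by blast
  have "is_pinv (cols_sub M S) Y"
    using M Y cols_sub_carrier[of M S] by (intro is_pinv_left_inverse) auto
  with Y(4) pinv_eqI[OF this] show "is_pinv (cols_sub M S) (pinv (cols_sub M S))"
    and "B = M - cols_sub M S * pinv (cols_sub M S) * M" by simp_all
qed

lemma css_state_step_eq:
  assumes "css_state M k S B" and M: "M \<in> carrier_mat p q"
    and i: "i < q" "col B i \<noteq> 0\<^sub>v p"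
  shows "M - cols_sub M (S @ [i]) * pinv (cols_sub M (S @ [i])) * M = proj_out_col B i"
proof -
  obtain Y where Y: "Y \<in> carrier_mat (length S) p" "Y * cols_sub M S = 1\<^sub>m (length S)"
    "transpose_mat (cols_sub M S * Y) = cols_sub M S * Y" "B = M - cols_sub M S * Y * M"
    using css_state_left_inverse[OF assms(1,2)] by blast
  from left_inverse_append_col[OF M Y i] obtain Y' where Y': "Y' \<in> carrier_mat (Suc (length S)) p"
    "Y' * cols_sub M (S @ [i]) = 1\<^sub>m (Suc (length S))"
    "transpose_mat (cols_sub M (S @ [i]) * Y') = cols_sub M (S @ [i]) * Y'"
    "M - cols_sub M (S @ [i]) * Y' * M = proj_out_col B i" by blast
  have "pinv (cols_sub M (S @ [i])) = Y'"
    using M Y' cols_sub_carrier[of M "S @ [i]"] by (intro pinv_eqI is_pinv_left_inverse) auto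
  with Y' show ?thesis by simp
qed

text \<open>The telescoping invariant with denominators cleared: for \<open>s = length S\<close>,
  the quantity \<open>(k - s + 1) * e_(k-s+1)(B) / e_(k-s)(B)\<close> never exceeds its initial
  value. The rank bound travels along to keep the denominators positive.\<close>

lemma css_state_minor_sum_le:
  assumes "css_state M k S B" and M: "M \<in> carrier_mat p q" and "k \<le> p"
    and rank: "k \<le> vec_space.rank p M"
  shows "B \<in> carrier_mat p q \<and> length S \<le> k \<and> k - length S \<le> vec_space.rank p B \<and>
    real (k - length S + 1) * minor_sum (gram B) (k - length S + 1) * minor_sum (gram M) k
      \<le> real (k + 1) * minor_sum (gram M) (k + 1) * minor_sum (gram B) (k - length S)"
  using assms(1)
proof induction
  case init
  then show ?case using M rank by simp
next
  case (step S B i)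
  define d where "d = k - length S - 1"
  have d: "k - length S = Suc d" using step.hyps(2) by (simp add: d_def)
  from step.IH have B: "B \<in> carrier_mat p q" and rk: "Suc d \<le> vec_space.rank p B"
    and IH: "real (Suc d + 1) * minor_sum (gram B) (Suc d + 1) * minor_sum (gram M) k
      \<le> real (k + 1) * minor_sum (gram M) (k + 1) * minor_sum (gram B) (Suc d)"
    by (auto simp: d)
  let ?P = "proj_out_col B i"
  have i: "is_arg_min (css_ratio B k (length S + 1)) (\<lambda>i. i < q \<and> col B i \<noteq> 0\<^sub>v p) i"
    using step.hyps(3) M by simp
  then have i': "i < q" "col B i \<noteq> 0\<^sub>v p" by (auto simp: is_arg_min_def)
  have eq: "M - cols_sub M (S @ [i]) * pinv (cols_sub M (S @ [i])) * M = ?P"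
    by (rule css_state_step_eq[OF step.hyps(1) M i'])
  have P: "?P \<in> carrier_mat p q" using B by (auto intro!: carrier_matI)
  have ratio: "real (Suc d) * minor_sum (gram B) (Suc d) * minor_sum (gram ?P) (Suc d)
      \<le> real (Suc d + 1) * minor_sum (gram B) (Suc d + 1) * minor_sum (gram ?P) d"
    using css_ratio_min_le[OF B \<open>k \<le> p\<close> step.hyps(2) _ i] rk d by simp
  have pos: "0 < minor_sum (gram B) (Suc d)" "0 < minor_sum (gram M) k"
    using minor_sum_gram_pos[of "Suc d" B] minor_sum_gram_pos[of k M] rk rank B M by auto
  have "minor_sum (gram B) (Suc d) * (real (Suc d) * minor_sum (gram ?P) (Suc d) * minor_sum (gram M) k)
      = real (Suc d) * minor_sum (gram B) (Suc d) * minor_sum (gram ?P) (Suc d) * minor_sum (gram M) k"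
    by (simp only: mult_ac)
  also have "\<dots> \<le> real (Suc d + 1) * minor_sum (gram B) (Suc d + 1) * minor_sum (gram ?P) d * minor_sum (gram M) k"
    using ratio pos by (intro mult_right_mono) auto
  also have "\<dots> = (real (Suc d + 1) * minor_sum (gram B) (Suc d + 1) * minor_sum (gram M) k) * minor_sum (gram ?P) d"
    by (simp only: mult_ac)
  also have "\<dots> \<le> (real (k + 1) * minor_sum (gram M) (k + 1) * minor_sum (gram B) (Suc d)) * minor_sum (gram ?P) d"
    by (rule mult_right_mono[OF IH minor_sum_gram_nonneg])
  also have "\<dots> = minor_sum (gram B) (Suc d) * (real (k + 1) * minor_sum (gram M) (k + 1) * minor_sum (gram ?P) d)"
    by (simp only: mult_ac)
  finally have "real (Suc d) * minor_sum (gram ?P) (Suc d) * minor_sum (gram M) k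
      \<le> real (k + 1) * minor_sum (gram M) (k + 1) * minor_sum (gram ?P) d"
    by (rule mult_left_le_imp_le[OF _ pos(1)])
  moreover have "d \<le> vec_space.rank p ?P" using rank_proj_out_col[of B i] rk B by simp
  moreover have "k - length (S @ [i]) = d" "length (S @ [i]) \<le> k" using step.hyps(2) d by auto
  ultimately show ?case using P unfolding eq by simp
qed

text \<open>After \<open>k\<close> iterations the invariant compares orders 1 and 0, so it bounds
  the squared Frobenius norm of the residual; \<open>minor_sum_gram_ratio_le\<close> replaces the
  quotient for \<open>M\<close> by the error of \<open>X\<close>.\<close>

lemma css_output_error_le:
  assumes out: "css_output M k S" and M: "M \<in> carrier_mat p q" and "k \<le> p"
    and rank: "k \<le> vec_space.rank p M"
    and X: "X \<in> carrier_mat p q" "vec_space.rank p X \<le> k"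
  shows "minor_sum (gram (M - cols_sub M S * pinv (cols_sub M S) * M)) 1
    \<le> real (k + 1) * minor_sum (gram (M - X)) 1"
proof -
  obtain B where B: "css_state M k S B" "length S = k" using out by (auto simp: css_output_def)
  have pos: "0 < minor_sum (gram M) k" using minor_sum_gram_pos[of k M] rank M by simp
  have "minor_sum (gram B) 1 * minor_sum (gram M) k \<le> real (k + 1) * minor_sum (gram M) (k + 1)"
    using css_state_minor_sum_le[OF B(1) M \<open>k \<le> p\<close> rank] B(2) by simp
  also have "\<dots> \<le> real (k + 1) * (minor_sum (gram M) k * minor_sum (gram (M - X)) 1)"
    using minor_sum_gram_ratio_le[OF M X] by (intro mult_left_mono) auto
  also have "\<dots> = (real (k + 1) * minor_sum (gram (M - X)) 1) * minor_sum (gram M) k" by simp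
  finally have "minor_sum (gram B) 1 \<le> real (k + 1) * minor_sum (gram (M - X)) 1"
    by (rule mult_right_le_imp_le[OF _ pos])
  then show ?thesis using css_state_pinv(2)[OF B(1) M] by simp
qed

section \<open>Frobenius norms and tensors\<close>

lemma minor_sum_gram_1: "minor_sum (gram M) 1 = (\<Sum>j<dim_col M. col M j \<bullet> col M j)"
  unfolding minor_sum_1 by simp

lemma minor_sum_gram_1_add_orthogonal:
  assumes A: "A \<in> carrier_mat p q" and C: "C \<in> carrier_mat p q"
    and orth: "transpose_mat A * C = 0\<^sub>m q q"
  shows "minor_sum (gram (A + C)) 1 = minor_sum (gram A) 1 + minor_sum (gram C) 1"
proof -
  have "col (A + C) j \<bullet> col (A + C) j = col A j \<bullet> col A j + col C j \<bullet> col C j" if j: "j < q" for j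
  proof -
    have v: "col A j \<in> carrier_vec p" "col C j \<in> carrier_vec p" using A C by auto
    have "col A j \<bullet> col C j = 0"
      using arg_cong[OF orth, of "\<lambda>M. M $$ (j, j)"] A C j by simp
    moreover have "col (A + C) j = col A j + col C j" using A C j by (intro eq_vecI) auto
    ultimately show ?thesis
      using v comm_scalar_prod[OF v]
      by (simp add: add_scalar_prod_distrib[of _ p] scalar_prod_add_distrib[of _ p])
  qed
  then show ?thesis using A C by (simp add: minor_sum_gram_1 sum.distrib del: One_nat_def)
qed

text \<open>Split \<open>M - P * Z\<close> into the orthogonal parts \<open>M - P * M\<close> and
  \<open>P * (M - Z)\<close>; the second is no longer than \<open>M - Z\<close>, again by
  Pythagoras.\<close>

lemma minor_sum_gram_1_projection_le:
  fixes M Z P :: "real mat"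
  assumes P: "P \<in> carrier_mat p p" "transpose_mat P = P" "P * P = P"
    and M: "M \<in> carrier_mat p q" and Z: "Z \<in> carrier_mat p q"
  shows "minor_sum (gram (M - P * Z)) 1
    \<le> minor_sum (gram (M - P * M)) 1 + minor_sum (gram (M - Z)) 1"
proof -
  let ?D = "M - Z"
  have c: "M - P * M \<in> carrier_mat p q" "P * ?D \<in> carrier_mat p q" "?D - P * ?D \<in> carrier_mat p q"
    "?D \<in> carrier_mat p q" "P * Z \<in> carrier_mat p q" "P * M \<in> carrier_mat p q"
    using P(1) M Z by auto
  have "P * (P * ?D) = P * ?D" using assoc_mult_mat[OF P(1) P(1) c(4)] P(3) by simp
  note orth = residual_orthogonal[OF _ P(1,2) c(2) this]
  have cancel: "U - W = (U - V) + (V - W)"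
    if "U \<in> carrier_mat p q" "V \<in> carrier_mat p q" "W \<in> carrier_mat p q" for U V W :: "real mat"
    using that by (intro eq_matI) auto
  have "P * ?D = P * M - P * Z" using P(1) M Z by (rule mult_minus_distrib_mat)
  then have "M - P * Z = (M - P * M) + P * ?D" using cancel[OF M c(6,5)] by (simp only:)
  then have 1: "minor_sum (gram (M - P * Z)) 1
      = minor_sum (gram (M - P * M)) 1 + minor_sum (gram (P * ?D)) 1"
    using minor_sum_gram_1_add_orthogonal[OF c(1,2) orth[OF M]] by (simp only:)
  have "U = (U - V) + V" if "U \<in> carrier_mat p q" "V \<in> carrier_mat p q" for U V :: "real mat"
    using that by (intro eq_matI) auto
  from this[OF c(4,2)] have "?D = (?D - P * ?D) + P * ?D" .
  then have "minor_sum (gram ?D) 1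
      = minor_sum (gram (?D - P * ?D)) 1 + minor_sum (gram (P * ?D)) 1"
    using minor_sum_gram_1_add_orthogonal[OF c(3,2) orth[OF c(4)]] by (simp only:)
  with 1 minor_sum_gram_nonneg[of "?D - P * ?D" 1] show ?thesis by linarith
qed

section \<open>Modes, matricizations and mode products\<close>

fun dim_mode :: "mode \<Rightarrow> nat \<times> nat \<times> nat \<Rightarrow> nat" where
  "dim_mode Mode1 (n1, n2, n3) = n1"
| "dim_mode Mode2 (n1, n2, n3) = n2"
| "dim_mode Mode3 (n1, n2, n3) = n3"

fun codim_mode :: "mode \<Rightarrow> nat \<times> nat \<times> nat \<Rightarrow> nat" where
  "codim_mode Mode1 (n1, n2, n3) = n2 * n3"
| "codim_mode Mode2 (n1, n2, n3) = n1 * n3"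
| "codim_mode Mode3 (n1, n2, n3) = n1 * n2"

lemma matricize_carrier:
  "matricize \<mu> A \<in> carrier_mat (dim_mode \<mu> (dims A)) (codim_mode \<mu> (dims A))"
  by (cases \<mu>; cases "dims A") auto

lemma upd_dims_dim_mode [simp]: "upd_dims \<mu> (dim_mode \<mu> d) d = d"
  by (cases \<mu>; cases d) auto

lemma upd_dims_upd_dims [simp]: "upd_dims \<mu> m (upd_dims \<mu> n d) = upd_dims \<mu> m d"
  by (cases \<mu>; cases d) auto

lemma mod_div_less:
  fixes j m n :: nat
  assumes "j < m * n"
  shows "j mod m < m" "j div m < n"
proof -
  from assms have "0 < m" by (cases m) auto
  then show "j mod m < m" by simp
  from assms show "j div m < n" by (simp add: less_mult_imp_div_less mult.commute)
qed

lemma dims_minus_tensor3 [simp]: "dims (A - B) = dims A"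
  by (simp add: minus_tensor3_def)

lemma matricize_minus:
  assumes "dims A = dims B"
  shows "matricize \<mu> (A - B) = matricize \<mu> A - matricize \<mu> B"
proof -
  obtain n1 n2 n3 where d: "dims A = (n1, n2, n3)" by (cases "dims A")
  with assms have "dims B = (n1, n2, n3)" by simp
  with d show ?thesis
    by (cases \<mu>) (auto intro!: eq_matI simp: minus_tensor3_def mod_div_less)
qed

lemma sum_mod_div:
  fixes f :: "nat \<Rightarrow> nat \<Rightarrow> real"
  shows "(\<Sum>j<m * n. f (j mod m) (j div m)) = (\<Sum>a<m. \<Sum>b<n. f a b)"
proof -
  have "(\<Sum>j<m * n. f (j mod m) (j div m)) = (\<Sum>(a, b)\<in>{..<m} \<times> {..<n}. f a b)"
    by (rule sum.reindex_bij_witness[of _ "\<lambda>(a, b). a + m * b" "\<lambda>j. (j mod m, j div m)"])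
      (auto simp: mod_div_less index_pair_less)
  then show ?thesis by (simp add: sum.cartesian_product)
qed

lemma frob_norm_nonneg: "0 \<le> frob_norm A"
  by (auto simp: frob_norm_def sum_nonneg split: prod.split)

lemma frob_norm_matricize: "(frob_norm A)\<^sup>2 = minor_sum (gram (matricize \<mu> A)) 1"
proof -
  obtain n1 n2 n3 where d: "dims A = (n1, n2, n3)" by (cases "dims A")
  have F: "(frob_norm A)\<^sup>2 = (\<Sum>i1<n1. \<Sum>i2<n2. \<Sum>i3<n3. (entry A i1 i2 i3)\<^sup>2)"
    by (simp add: frob_norm_def d sum_nonneg)
  have swap12: "(\<Sum>i1<n1. \<Sum>i2<n2. \<Sum>i3<n3. (entry A i1 i2 i3)\<^sup>2)
      = (\<Sum>i2<n2. \<Sum>i1<n1. \<Sum>i3<n3. (entry A i1 i2 i3)\<^sup>2)"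
    by (rule sum.swap)
  have rot: "(\<Sum>i1<n1. \<Sum>i2<n2. \<Sum>i3<n3. (entry A i1 i2 i3)\<^sup>2)
      = (\<Sum>i3<n3. \<Sum>i1<n1. \<Sum>i2<n2. (entry A i1 i2 i3)\<^sup>2)"
  proof -
    have "(\<Sum>i1<n1. \<Sum>i2<n2. \<Sum>i3<n3. (entry A i1 i2 i3)\<^sup>2)
        = (\<Sum>i1<n1. \<Sum>i3<n3. \<Sum>i2<n2. (entry A i1 i2 i3)\<^sup>2)"
      by (intro sum.cong refl sum.swap)
    also have "\<dots> = (\<Sum>i3<n3. \<Sum>i1<n1. \<Sum>i2<n2. (entry A i1 i2 i3)\<^sup>2)"
      by (rule sum.swap)
    finally show ?thesis .
  qed
  have G: "minor_sum (gram M) 1 = (\<Sum>i<dim_row M. \<Sum>j<dim_col M. (M $$ (i, j))\<^sup>2)" for M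
    unfolding minor_sum_gram_1 scalar_prod_self by (subst sum.swap) (simp add: col_def)
  show ?thesis
  proof (cases \<mu>)
    case Mode1
    then show ?thesis unfolding F G using sum_mod_div[of "\<lambda>a b. (entry A _ a b)\<^sup>2" n2 n3] by (simp add: d)
  next
    case Mode2
    then show ?thesis unfolding F G swap12
      using sum_mod_div[of "\<lambda>a b. (entry A a _ b)\<^sup>2" n1 n3] by (simp add: d)
  next
    case Mode3
    then show ?thesis unfolding F G rot
      using sum_mod_div[of "\<lambda>a b. (entry A a b _)\<^sup>2" n1 n2] by (simp add: d)
  qed
qed

lemma mode_prod_mode_prod:
  assumes B: "B \<in> carrier_mat m l" and B': "B' \<in> carrier_mat l (dim_mode \<mu> (dims A))"
  shows "mode_prod \<mu> B (mode_prod \<mu> B' A) = mode_prod \<mu> (B * B') A"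
proof (rule matricize_inject)
  show "matricize \<mu> (mode_prod \<mu> B (mode_prod \<mu> B' A)) = matricize \<mu> (mode_prod \<mu> (B * B') A)"
    unfolding matricize_mode_prod using assoc_mult_mat[OF B B' matricize_carrier] by simp
qed (use B B' in \<open>simp add: dims_mode_prod\<close>)

lemma entry_mode_prod:
  assumes "dims A = (n1, n2, n3)"
  shows "dim_col B = n1 \<Longrightarrow> i1 < dim_row B \<Longrightarrow> i2 < n2 \<Longrightarrow> i3 < n3 \<Longrightarrow>
      entry (mode_prod Mode1 B A) i1 i2 i3 = (\<Sum>a<n1. B $$ (i1, a) * entry A a i2 i3)"
    and "dim_col B = n2 \<Longrightarrow> i1 < n1 \<Longrightarrow> i2 < dim_row B \<Longrightarrow> i3 < n3 \<Longrightarrow>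
      entry (mode_prod Mode2 B A) i1 i2 i3 = (\<Sum>a<n2. B $$ (i2, a) * entry A i1 a i3)"
    and "dim_col B = n3 \<Longrightarrow> i1 < n1 \<Longrightarrow> i2 < n2 \<Longrightarrow> i3 < dim_row B \<Longrightarrow>
      entry (mode_prod Mode3 B A) i1 i2 i3 = (\<Sum>a<n3. B $$ (i3, a) * entry A i1 i2 a)"
  using assms
  by (auto simp: mode_prod_def scalar_prod_def index_pair_less lessThan_atLeast0 intro!: sum.cong)

text \<open>Entrywise this exchanges two finite sums. Three pairs of modes are checked; the reversed
  pairs follow by symmetry.\<close>

lemma mode_prod_commute:
  assumes "\<mu> \<noteq> \<nu>" and B: "dim_col B = dim_mode \<mu> (dims A)" and B': "dim_col B' = dim_mode \<nu> (dims A)"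
  shows "mode_prod \<mu> B (mode_prod \<nu> B' A) = mode_prod \<nu> B' (mode_prod \<mu> B A)"
proof -
  obtain n1 n2 n3 where d: "dims A = (n1, n2, n3)" by (cases "dims A")
  have swap: "(\<Sum>a<m. f a * (\<Sum>b<n. g b * h a b)) = (\<Sum>b<n. g b * (\<Sum>a<m. f a * h a b))"
    for f g :: "nat \<Rightarrow> real" and h m n
  proof -
    have "(\<Sum>a<m. f a * (\<Sum>b<n. g b * h a b)) = (\<Sum>a<m. \<Sum>b<n. g b * (f a * h a b))"
      unfolding sum_distrib_left by (intro sum.cong refl mult.left_commute)
    also have "\<dots> = (\<Sum>b<n. \<Sum>a<m. g b * (f a * h a b))"
      by (rule sum.swap)
    finally show ?thesis by (simp only: sum_distrib_left)
  qed
  note simps = d dims_mode_prod entry_mode_prod[OF d]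
  have 12: "mode_prod Mode1 B (mode_prod Mode2 B' A) = mode_prod Mode2 B' (mode_prod Mode1 B A)"
    if "dim_col B = n1" "dim_col B' = n2" for B B'
  proof (rule tensor3_eqI)
    fix i1 i2 i3 assume i: "i1 < dim_row B" "i2 < dim_row B'" "i3 < n3"
    show "entry (mode_prod Mode1 B (mode_prod Mode2 B' A)) i1 i2 i3
        = entry (mode_prod Mode2 B' (mode_prod Mode1 B A)) i1 i2 i3"
      using i that by (simp add: entry_mode_prod[of _ n1 "dim_row B'" n3]
        entry_mode_prod[of _ "dim_row B" n2 n3] simps) (rule swap)
  qed (simp_all add: simps)
  have 13: "mode_prod Mode1 B (mode_prod Mode3 B' A) = mode_prod Mode3 B' (mode_prod Mode1 B A)"
    if "dim_col B = n1" "dim_col B' = n3" for B B'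
  proof (rule tensor3_eqI)
    fix i1 i2 i3 assume i: "i1 < dim_row B" "i2 < n2" "i3 < dim_row B'"
    show "entry (mode_prod Mode1 B (mode_prod Mode3 B' A)) i1 i2 i3
        = entry (mode_prod Mode3 B' (mode_prod Mode1 B A)) i1 i2 i3"
      using i that by (simp add: entry_mode_prod[of _ n1 n2 "dim_row B'"]
        entry_mode_prod[of _ "dim_row B" n2 n3] simps) (rule swap)
  qed (simp_all add: simps)
  have 23: "mode_prod Mode2 B (mode_prod Mode3 B' A) = mode_prod Mode3 B' (mode_prod Mode2 B A)"
    if "dim_col B = n2" "dim_col B' = n3" for B B'
  proof (rule tensor3_eqI)
    fix i1 i2 i3 assume i: "i1 < n1" "i2 < dim_row B" "i3 < dim_row B'"
    show "entry (mode_prod Mode2 B (mode_prod Mode3 B' A)) i1 i2 i3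
        = entry (mode_prod Mode3 B' (mode_prod Mode2 B A)) i1 i2 i3"
      using i that by (simp add: entry_mode_prod[of _ n1 n2 "dim_row B'"]
        entry_mode_prod[of _ n1 "dim_row B" n3] simps) (rule swap)
  qed (simp_all add: simps)
  show ?thesis
    using assms by (cases \<mu>; cases \<nu>) (simp_all add: d 12 13 23)
qed

section \<open>Combining the errors of the three modes\<close>

lemma frob_norm_projection_le:
  assumes P: "P \<in> carrier_mat (dim_mode \<mu> (dims A)) (dim_mode \<mu> (dims A))"
    "transpose_mat P = P" "P * P = P"
    and Z: "dims Z = dims A"
  shows "(frob_norm (A - mode_prod \<mu> P Z))\<^sup>2
    \<le> (frob_norm (A - mode_prod \<mu> P A))\<^sup>2 + (frob_norm (A - Z))\<^sup>2"
proof -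
  have d: "dims (mode_prod \<mu> P Z) = dims A" "dims (mode_prod \<mu> P A) = dims A"
    using P(1) Z by (simp_all add: dims_mode_prod)
  show ?thesis
    unfolding frob_norm_matricize[of _ \<mu>]
    using minor_sum_gram_1_projection_le[OF P matricize_carrier, of "matricize \<mu> Z"]
      matricize_carrier[of \<mu> Z] Z d
    by (simp add: matricize_minus matricize_mode_prod del: matricize.simps One_nat_def)
qed

lemma css_projection:
  assumes "css_output M k S" and M: "M \<in> carrier_mat p q" and B: "B = cols_sub M S"
  defines "P \<equiv> B * pinv B"
  shows "B \<in> carrier_mat p k" "pinv B \<in> carrier_mat k p"
    "P \<in> carrier_mat p p" "transpose_mat P = P" "P * P = P"
proof -
  obtain B' where "css_state M k S B'" and S: "length S = k"
    using assms(1) by (auto simp: css_output_def)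
  then have pinv: "is_pinv B (pinv B)" using css_state_pinv(1)[OF _ M] B by simp
  show Bc: "B \<in> carrier_mat p k" using M S cols_sub_carrier[of M S] by (simp add: B)
  with pinv show Yc: "pinv B \<in> carrier_mat k p" by (simp add: is_pinv_def)
  from Bc Yc show "P \<in> carrier_mat p p" by (simp add: P_def)
  from pinv show "transpose_mat P = P" by (simp add: is_pinv_def P_def)
  have "P * P = (P * B) * pinv B"
    unfolding P_def using Bc Yc by (intro assoc_mult_mat[symmetric]) auto
  then show "P * P = P" using pinv by (simp add: is_pinv_def P_def)
qed

text \<open>A competing tensor becomes a low-rank competitor for the matricization, so one and the
  same \<open>X\<close> can serve in all three modes.\<close>

lemma css_output_frob_norm_le:
  assumes "css_output (matricize \<mu> A) k S" and "k \<le> dim_mode \<mu> (dims A)"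
    and "k \<le> vec_space.rank (dim_mode \<mu> (dims A)) (matricize \<mu> A)"
    and X: "dims X = dims A" "vec_space.rank (dim_mode \<mu> (dims A)) (matricize \<mu> X) \<le> k"
    and B: "B = cols_sub (matricize \<mu> A) S"
  shows "(frob_norm (A - mode_prod \<mu> (B * pinv B) A))\<^sup>2 \<le> real (k + 1) * (frob_norm (A - X))\<^sup>2"
proof -
  have "B \<in> carrier_mat (dim_mode \<mu> (dims A)) k"
    by (rule css_projection(1)[OF assms(1) matricize_carrier B])
  then have "dims (mode_prod \<mu> (B * pinv B) A) = dims A" by (simp add: dims_mode_prod)
  then show ?thesis
    unfolding frob_norm_matricize[of _ \<mu>]
    using css_output_error_le[OF assms(1) matricize_carrier assms(2,3), of "matricize \<mu> X"]
      matricize_carrier[of \<mu> X] X B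
    by (simp add: matricize_minus matricize_mode_prod del: matricize.simps One_nat_def)
qed

theorem corollary6:
  fixes A A_best C :: tensor3
    and B1 B2 B3 :: "real mat"
    and n1 n2 n3 k1 k2 k3 :: nat
    and S1 S2 S3 :: "nat list"
  assumes "dims A = (n1, n2, n3)"
    and "1 \<le> k1" "k1 \<le> n1" "1 \<le> k2" "k2 \<le> n2" "1 \<le> k3" "k3 \<le> n3"
    and "vec_space.rank n1 (matricize Mode1 A) \<ge> k1"
    and "vec_space.rank n2 (matricize Mode2 A) \<ge> k2"
    and "vec_space.rank n3 (matricize Mode3 A) \<ge> k3"
    and "css_output (matricize Mode1 A) k1 S1"
    and "css_output (matricize Mode2 A) k2 S2"
    and "css_output (matricize Mode3 A) k3 S3"
    and "B1 = cols_sub (matricize Mode1 A) S1"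
    and "B2 = cols_sub (matricize Mode2 A) S2"
    and "B3 = cols_sub (matricize Mode3 A) S3"
    and "C = mode_prod Mode1 (pinv B1) (mode_prod Mode2 (pinv B2) (mode_prod Mode3 (pinv B3) A))"
    and "best_mlrank_approx A k1 k2 k3 A_best"
  shows "frob_norm (A - mode_prod Mode1 B1 (mode_prod Mode2 B2 (mode_prod Mode3 B3 C)))
           \<le> sqrt (real (k1 + k2 + k3 + 3)) * frob_norm (A - A_best)"
proof -
  note d = assms(1)
  note css1 = css_projection[OF assms(11) matricize_carrier assms(14)]
    and css2 = css_projection[OF assms(12) matricize_carrier assms(15)]
    and css3 = css_projection[OF assms(13) matricize_carrier assms(16)]
  note B = css1(1) css2(1) css3(1) and Y = css1(2) css2(2) css3(2) and P = css1(3) css2(3) css3(3)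
  define P1 P2 P3 where "P1 = B1 * pinv B1" and "P2 = B2 * pinv B2" and "P3 = B3 * pinv B3"
  note P_defs = P1_def P2_def P3_def
  \<comment> \<open>\<open>Z3\<close> and \<open>Z2\<close> project \<open>A\<close> in mode 3 and
    then in mode 2. Commuting products in distinct modes brings each factor next to its
    pseudoinverse, so the approximation becomes \<open>mode_prod Mode1 P1 Z2\<close>.\<close>
  define Z3 where "Z3 = mode_prod Mode3 P3 A"
  define Z2 where "Z2 = mode_prod Mode2 P2 Z3"
  have dims_Z: "dims Z3 = dims A" "dims Z2 = dims A"
    using B by (simp_all add: Z2_def Z3_def P_defs d dims_mode_prod)
  let ?Y3 = "mode_prod Mode3 (pinv B3) A"
  let ?Y2 = "mode_prod Mode2 (pinv B2) ?Y3"
  have dims_Y: "dims ?Y3 = (n1, n2, k3)" "dims ?Y2 = (n1, k2, k3)"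
    using Y by (simp_all add: d dims_mode_prod)
  have Z3: "mode_prod Mode3 B3 ?Y3 = Z3"
    using mode_prod_mode_prod[OF B(3), of "pinv B3" Mode3 A] Y by (simp add: Z3_def P_defs)
  have Z2: "mode_prod Mode2 B2 (mode_prod Mode3 B3 ?Y2) = Z2"
  proof -
    have "mode_prod Mode3 B3 ?Y2 = mode_prod Mode2 (pinv B2) Z3"
      using B Y by (subst mode_prod_commute) (simp_all add: dims_Y Z3 d)
    then show ?thesis
      using mode_prod_mode_prod[OF B(2), of "pinv B2" Mode2 Z3] Y dims_Z by (simp add: Z2_def P_defs)
  qed
  have "mode_prod Mode3 B3 C = mode_prod Mode1 (pinv B1) (mode_prod Mode3 B3 ?Y2)"
    unfolding assms(17) using B Y by (subst mode_prod_commute) (simp_all add: dims_Y d)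
  moreover have "mode_prod Mode2 B2 (mode_prod Mode1 (pinv B1) (mode_prod Mode3 B3 ?Y2))
      = mode_prod Mode1 (pinv B1) Z2"
    using B Y by (subst mode_prod_commute) (simp_all add: dims_Y d Z2 dims_mode_prod)
  moreover have "mode_prod Mode1 B1 (mode_prod Mode1 (pinv B1) Z2) = mode_prod Mode1 P1 Z2"
    using mode_prod_mode_prod[OF B(1), of "pinv B1" Mode1 Z2] Y dims_Z by (simp add: P_defs)
  ultimately have eq: "mode_prod Mode1 B1 (mode_prod Mode2 B2 (mode_prod Mode3 B3 C))
      = mode_prod Mode1 P1 Z2" by simp
  have best: "dims A_best = dims A"
    "vec_space.rank n1 (matricize Mode1 A_best) \<le> k1"
    "vec_space.rank n2 (matricize Mode2 A_best) \<le> k2"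
    "vec_space.rank n3 (matricize Mode3 A_best) \<le> k3"
    using assms(18) d
    by (auto simp: best_mlrank_approx_def is_arg_min_def mlrank_le_def simp del: matricize.simps)
  have 1: "(frob_norm (A - mode_prod Mode1 P1 A))\<^sup>2 \<le> real (k1 + 1) * (frob_norm (A - A_best))\<^sup>2"
    unfolding P_defs using assms best
    by (intro css_output_frob_norm_le) (simp_all del: matricize.simps)
  have 2: "(frob_norm (A - mode_prod Mode2 P2 A))\<^sup>2 \<le> real (k2 + 1) * (frob_norm (A - A_best))\<^sup>2"
    unfolding P_defs using assms best
    by (intro css_output_frob_norm_le) (simp_all del: matricize.simps)
  have 3: "(frob_norm (A - Z3))\<^sup>2 \<le> real (k3 + 1) * (frob_norm (A - A_best))\<^sup>2"
    unfolding P_defs Z3_def using assms best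
    by (intro css_output_frob_norm_le) (simp_all del: matricize.simps)
  \<comment> \<open>Peel off the modes one at a time. Each contributes only the error of projecting
    \<open>A\<close> itself, so the constants add up to
    \<open>(k1 + 1) + (k2 + 1) + (k3 + 1)\<close>.\<close>
  have "(frob_norm (A - mode_prod Mode1 P1 Z2))\<^sup>2
      \<le> (frob_norm (A - mode_prod Mode1 P1 A))\<^sup>2 + (frob_norm (A - Z2))\<^sup>2"
    unfolding P_defs by (rule frob_norm_projection_le[OF css1(3-5) dims_Z(2)])
  also have "(frob_norm (A - Z2))\<^sup>2 \<le> (frob_norm (A - mode_prod Mode2 P2 A))\<^sup>2 + (frob_norm (A - Z3))\<^sup>2"
    unfolding P_defs Z2_def by (rule frob_norm_projection_le[OF css2(3-5) dims_Z(1)])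
  finally have "(frob_norm (A - mode_prod Mode1 P1 Z2))\<^sup>2
      \<le> real (k1 + k2 + k3 + 3) * (frob_norm (A - A_best))\<^sup>2"
    using 1 2 3 by (simp add: algebra_simps)
  then have "sqrt ((frob_norm (A - mode_prod Mode1 P1 Z2))\<^sup>2)
      \<le> sqrt (real (k1 + k2 + k3 + 3) * (frob_norm (A - A_best))\<^sup>2)"
    by (rule real_sqrt_le_mono)
  then show ?thesis
    unfolding eq real_sqrt_mult real_sqrt_abs by (simp add: frob_norm_nonneg)
qed

end
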